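(* Let $C\subset\mathbb{R}^d$ be a closed strictly convex cone with the apex at $0$ and a nonempty interior. Suppose that $\Delta\subset C$ is a convex closed subset with a bounded complement in $C$, and $A=C\setminus(\Delta\cup\{0\})$ is the corresponding $C$-coconvex body. Fix a linear function $\xi:\mathbb{R}^d\to\mathbb{R}$ such that $\xi\ge 0$ on $C$ and $\xi^{-1}(0)\cap C=\{0\}$; set $\Delta_t=\Delta\cap\{\xi\le t\}$ and $C_t=C\cap\{\xi\le t\}$. (1) The function $-\mathbb{I}_A$ is a virtual polytope. Moreover, $-\mathbb{I}_A=\mathbb{I}_{\Delta_t}*\mathbb{I}_{C_t}^{-1}$ for all sufficiently large $t\in\mathbb{R}$. (2) If $A$ and $B$ are $C$-coconvex bodies, then $-\mathbb{I}_{A\oplus B}=(-\mathbb{I}_A)*(-\mathbb{I}_B)$.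
   Context: $\mathbb{I}_X$ denotes the indicator function of $X$ (equal to $1$ on $X$ and $0$ elsewhere). A $C$-coconvex body is a set of the form $A=C\setminus(\Delta_A\cup\{0\})$, where $\Delta_A\subset C$ is a closed convex set such that $C\setminus\Delta_A$ is bounded and nonempty. For $C$-coconvex bodies $A=C\setminus(\Delta_A\cup\{0\})$ and $B=C\setminus(\Delta_B\cup\{0\})$, one sets $A\oplus B=C\setminus((\Delta_A+\Delta_B)\cup\{0\})$, where $+$ is the Minkowski sum. Virtual polytopes. Let $\mathcal R(\mathbb{R}^d)$ be the smallest ring of sets containing all closed half-spaces of $\mathbb{R}^d$. There is a unique finitely additive measure $\chi$ on $\mathcal R(\mathbb{R}^d)$ such that, for every closed bounded $X\in\mathcal R(\mathbb{R}^d)$, $\chi(X)$ is the Euler characteristic of $X$. Let $Z_c(\mathbb{R}^d)$ be the set of compactly supported functions $\mathbb{R}^d\to\mathbb{Z}$ measurable with respect to $\mathcal R(\mathbb{R}^d)$; its additive group is spanned by the indicator functions of convex polytopes. The Minkowski product on $Z_c(\mathbb{R}^d)$ is $\alpha*\beta(x)=\int\alpha(y)\beta(x-y)\,d\chi(y)$ (integration over $\mathbb{R}^d$ with respect to $\chi$). It satisfies $\mathbb{I}_P*\mathbb{I}_Q=\mathbb{I}_{P+Q}$ for convex polytopes $P,Q$, and has identity element $\mathbb{I}_{\{0\}}$. For every convex polytope $P$, $\mathbb{I}_P$ is invertible for $*$, with inverse denoted $\mathbb{I}_P^{-1}$. A virtual (convex) polytope is an element of $Z_c(\mathbb{R}^d)$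 of the form $\mathbb{I}_P*\mathbb{I}_Q^{-1}$ with $P,Q$ convex polytopes.
   Formalization: The formal theorem also assumes that Δ (and in part (2) the sets Δ_A, Δ_B) is a polyhedron, a finite intersection of closed half-spaces; otherwise the indicator of A is not in Z_c(R^d), so (1) is false and the product in (2) is undefined. *)

theory Defs
  imports "HOL-Analysis.Analysis"
begin

definition strictly_convex_cone :: "'a::euclidean_space set \<Rightarrow> bool" where
  "strictly_convex_cone C \<longleftrightarrow> convex_cone C \<and> (\<forall>L. subspace L \<and> L \<subseteq> C \<longrightarrow> L = {0})"

definition coconvex_body :: "'a::euclidean_space set \<Rightarrow> 'a set \<Rightarrow> 'a set \<Rightarrow> bool" where
  "coconvex_body C \<Delta> A \<longleftrightarrow>
     closed \<Delta> \<and> convex \<Delta> \<and> \<Delta> \<subseteq> C \<and> bounded (C - \<Delta>) \<and> C - \<Delta> \<noteq> {} \<and>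
     A = C - (\<Delta> \<union> {0})"

definition halfspace_ring :: "'a::euclidean_space set set" where
  "halfspace_ring =
     \<Inter> {M. ring_of_sets UNIV M \<and> (\<forall>a b. a \<noteq> 0 \<longrightarrow> {x. a \<bullet> x \<le> b} \<in> M)}"

text \<open>Euler characteristic of a compact polyhedron: the alternating number of simplices of any
  triangulation. A \<^const>\<open>simplicial_complex\<close> may contain the empty face, which is not counted.\<close>

definition euler_char :: "'a::euclidean_space set \<Rightarrow> int" where
  "euler_char X =
     (THE n. \<exists>\<T>. simplicial_complex \<T> \<and> \<Union>\<T> = X \<and> n = (\<Sum>S\<in>\<T> - {{}}. (-1) ^ nat (aff_dim S)))"

text \<open>The condition determines the measure on bounded members of the ring. It leaves some
  freedom on unbounded ones (in dimension one, the common value on all closed right rays is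
  arbitrary), but these never contribute to the integral of a function with bounded support.\<close>

definition euler_measure :: "'a::euclidean_space set \<Rightarrow> int" where
  "euler_measure =
     (SOME \<mu>. additive halfspace_ring \<mu> \<and>
        (\<forall>X\<in>halfspace_ring. closed X \<and> bounded X \<longrightarrow> \<mu> X = euler_char X))"

text \<open>Finiteness of the range is part of measurability with respect to a mere ring of sets; it
  makes \<open>Zc\<close> the group spanned by the indicator functions of polytopes.\<close>

definition Zc :: "('a::euclidean_space \<Rightarrow> int) set" where
  "Zc = {f. finite (range f) \<and> (\<forall>n. f -` {n} \<in> halfspace_ring) \<and> compact (closure {x. f x \<noteq> 0})}"

definition euler_integral :: "('a::euclidean_space \<Rightarrow> int) \<Rightarrow> int" where
  "euler_integral f = (\<Sum>n\<in>range f. n * euler_measure (f -` {n}))"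

definition mink_prod :: "('a::euclidean_space \<Rightarrow> int) \<Rightarrow> ('a \<Rightarrow> int) \<Rightarrow> 'a \<Rightarrow> int"
    (infixl "\<star>" 70) where
  "\<alpha> \<star> \<beta> = (\<lambda>x. euler_integral (\<lambda>y. \<alpha> y * \<beta> (x - y)))"

definition mink_inverse :: "('a::euclidean_space \<Rightarrow> int) \<Rightarrow> 'a \<Rightarrow> int" where
  "mink_inverse \<alpha> = (THE \<beta>. \<beta> \<in> Zc \<and> \<alpha> \<star> \<beta> = indicator {0})"

text \<open>\<^const>\<open>polytope\<close> admits the empty set, whose indicator function is not invertible.\<close>

definition virtual_polytope :: "('a::euclidean_space \<Rightarrow> int) \<Rightarrow> bool" where
  "virtual_polytope \<alpha> \<longleftrightarrow>
     \<alpha> \<in> Zc \<and>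
     (\<exists>P Q. polytope P \<and> P \<noteq> {} \<and> polytope Q \<and> Q \<noteq> {} \<and>
        \<alpha> = indicator P \<star> mink_inverse (indicator Q))"

end

theory Submission
  imports Defs
begin

text \<open>Projecting along one direction after another shows that an integer combination of nonempty
  closed convex sets whose indicator functions add up to \<open>0\<close> has total weight \<open>0\<close>. So there is a
  linear functional \<open>chi\<close> giving every nonempty closed convex set the value \<open>1\<close>; projecting again, it
  gives a bounded relatively open convex set the value \<open>(-1) ^ dim\<close>. Sign cells of a
  finite hyperplane arrangement triangulate the compact members of the half-space ring and identify
  the Euler integral with \<open>chi\<close>, whence the Minkowski product is a convolution that is bilinear,
  associative, and turns indicators of compact convex sets into that of their sum. On a line parallel
  to \<open>x \<noteq> 0\<close>, the set \<open>P \<inter> (x + rel_interior P)\<close> is empty or half-open, so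
  \<open>(-1) ^ dim\<close> times the indicator of \<open>- rel_interior P\<close> inverts that of \<open>P\<close>.

  For a coconvex body and large \<open>t\<close>, minus its indicator is that of \<open>\<Delta>\<^sub>t\<close> minus that of \<open>C\<^sub>t\<close> plus
  that of \<open>0\<close>. Both claims follow by expanding products, since \<open>\<Delta>\<close> and \<open>C\<close> coincide far
  out, which makes truncations add up: \<open>\<Delta>\<^sub>t + \<Delta>'\<^sub>t\<close> is the truncation of \<open>\<Delta> + \<Delta>'\<close> at \<open>2t\<close>.\<close>

section \<open>Integer combinations of convex sets\<close>

text \<open>A list of pairs encodes a formal integer combination of sets. Its weight is what \<open>chi\<close> below
  assigns to the corresponding combination of indicator functions if all sets are nonempty, closed
  and convex.\<close>

definition lincomb :: "(int \<times> 'a set) list \<Rightarrow> 'a \<Rightarrow> int" where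
  "lincomb ps x = (\<Sum>(n, S)\<leftarrow>ps. n * indicator S x)"

definition weight :: "(int \<times> 'a set) list \<Rightarrow> int" where
  "weight ps = (\<Sum>(n, S)\<leftarrow>ps. n)"

definition convex_comb :: "(int \<times> 'a::euclidean_space set) list \<Rightarrow> bool" where
  "convex_comb ps \<longleftrightarrow> (\<forall>S\<in>snd ` set ps. closed S \<and> convex S \<and> S \<noteq> {})"

lemma lincomb_simps [simp]:
  "lincomb [] x = 0"
  "lincomb ((n, S) # ps) x = n * indicator S x + lincomb ps x"
  "lincomb (ps @ qs) x = lincomb ps x + lincomb qs x"
  by (auto simp: lincomb_def)

lemma weight_simps [simp]:
  "weight [] = 0"
  "weight ((n, S) # ps) = n + weight ps"
  "weight (ps @ qs) = weight ps + weight qs"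
  "weight (map (apsnd g) ps) = weight ps"
  by (auto simp: weight_def apsnd_def map_prod_def case_prod_unfold o_def)

lemma convex_comb_simps [simp]:
  "convex_comb []"
  "convex_comb ((n, S) # ps) \<longleftrightarrow> closed S \<and> convex S \<and> S \<noteq> {} \<and> convex_comb ps"
  "convex_comb (ps @ qs) \<longleftrightarrow> convex_comb ps \<and> convex_comb qs"
  by (auto simp: convex_comb_def)

lemma lincomb_scale [simp]: "lincomb (map (apfst ((*) c)) ps) x = c * lincomb ps x"
  by (induction ps) (auto simp: algebra_simps)

lemma weight_scale [simp]: "weight (map (apfst ((*) c)) ps) = c * weight ps"
  by (induction ps) (auto simp: algebra_simps)

lemma convex_comb_scale [simp]: "convex_comb (map (apfst ((*) c)) ps) \<longleftrightarrow> convex_comb ps"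
  by (induction ps) auto

lemma lincomb_Int: "lincomb (map (apsnd (\<lambda>S. S \<inter> T)) ps) x = lincomb ps x * indicator T x"
  by (induction ps) (auto simp: algebra_simps indicator_def)

section \<open>Combinations of intervals on the real line\<close>

lemma sum_list_sum_swap:
  fixes f :: "'b \<Rightarrow> 'c \<Rightarrow> 'd::comm_monoid_add"
  shows "(\<Sum>x\<leftarrow>xs. \<Sum>t\<in>E. f x t) = (\<Sum>t\<in>E. \<Sum>x\<leftarrow>xs. f x t)"
  by (induction xs) (auto simp: sum.distrib)

text \<open>A compact convex set is an interval \<open>{a..b}\<close>. Its indicator is continuous
  from the right everywhere except at \<open>b\<close>, where it drops from 1 to 0.\<close>

lemma eventually_right_jump:
  fixes S :: "real set"
  assumes "compact S" "convex S" "S \<noteq> {}"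
  shows "\<forall>\<^sub>F s in at_right t.
    (indicator S t :: int) - indicator S s = of_bool (Sup S = t)"
proof -
  obtain a b where S: "S = {a..b}"
    using assms connected_compact_interval_1[of S] convex_connected by auto
  with assms have ab: "a \<le> b" by auto
  show ?thesis
  proof (cases "t < a \<or> (a \<le> t \<and> t < b)")
    case True
    define c where "c = (if t < a then a else b)"
    have "t < c" using True by (auto simp: c_def)
    then have "\<forall>\<^sub>F s in at_right t. t < s \<and> s < c"
      using eventually_at_right_field eventually_conj_iff by auto
    then show ?thesis
      by eventually_elim (use True ab S in \<open>auto simp: c_def indicator_def split: if_splits\<close>)
  next
    case False
    have "\<forall>\<^sub>F s in at_right t. t < s"
      using eventually_at_right_less by blast
    then show ?thesis
      by eventually_elim (use False ab S in \<open>auto simp: indicator_def\<close>)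
  qed
qed

text \<open>Each interval is counted at its right endpoint, where its indicator function jumps.\<close>

lemma weight_eq_0_real_compact:
  fixes ps :: "(int \<times> real set) list"
  assumes ps: "\<forall>S\<in>snd ` set ps. compact S \<and> convex S \<and> S \<noteq> {}"
    and zero: "\<And>t. lincomb ps t = 0"
  shows "weight ps = 0"
proof -
  have jump: "(\<Sum>(n, S)\<leftarrow>ps. n * of_bool (Sup S = t)) = 0" for t
  proof -
    have "\<forall>\<^sub>F s in at_right t. \<forall>p\<in>set ps.
        (indicator (snd p) t :: int) - indicator (snd p) s = of_bool (Sup (snd p) = t)"
      using ps by (intro eventually_ball_finite ballI eventually_right_jump) auto
    then obtain s where s: "\<And>p. p \<in> set ps \<Longrightarrow>
        (indicator (snd p) t :: int) - indicator (snd p) s = of_bool (Sup (snd p) = t)"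
      using eventually_happens'[OF trivial_limit_at_right_real] by blast
    \<comment> \<open>Only finitely many sets occur, so one \<open>s\<close> serves them all. The
      jump of the zero combination counts, with coefficients, the intervals that end at
      \<open>t\<close>.\<close>
    have "0 = lincomb ps t - lincomb ps s" by (simp add: zero)
    also have "\<dots> = (\<Sum>p\<leftarrow>ps. fst p * (indicator (snd p) t - indicator (snd p) s))"
      by (simp add: lincomb_def case_prod_unfold sum_list_subtractf right_diff_distrib)
    also have "\<dots> = (\<Sum>p\<leftarrow>ps. fst p * of_bool (Sup (snd p) = t))"
      by (intro arg_cong[where f=sum_list] map_cong refl) (simp only: s)
    finally show ?thesis by (simp add: case_prod_unfold)
  qed
  define E where "E = (\<lambda>p. Sup (snd p)) ` set ps"
  have "weight ps = (\<Sum>p\<leftarrow>ps. \<Sum>t\<in>E. fst p * of_bool (Sup (snd p) = t))"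
    unfolding weight_def case_prod_unfold
  proof (intro arg_cong[where f=sum_list] map_cong refl)
    fix p assume "p \<in> set ps"
    then have "Sup (snd p) \<in> E" "finite E" by (auto simp: E_def)
    then show "fst p = (\<Sum>t\<in>E. fst p * of_bool (Sup (snd p) = t))"
      by (simp add: of_bool_def mult_delta_right sum.delta)
  qed
  also have "\<dots> = 0"
    using jump by (simp add: sum_list_sum_swap case_prod_unfold)
  finally show ?thesis .
qed

text \<open>Supplies a radius at which all sets can be cut down to compact ones. None becomes empty,
  so the weight is kept, and a combination that vanishes everywhere still does.\<close>

lemma convex_comb_meets_cball:
  assumes "convex_comb ps"
  obtains R where "\<And>S. S \<in> snd ` set ps \<Longrightarrow> S \<inter> cball 0 R \<noteq> {}"
proof -
  obtain y where y: "\<And>S. S \<in> snd ` set ps \<Longrightarrow> y S \<in> S"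
    using assms unfolding convex_comb_def by (metis ex_in_conv)
  have "bounded (y ` snd ` set ps)" by (intro finite_imp_bounded) auto
  then obtain R where "\<And>S. S \<in> snd ` set ps \<Longrightarrow> norm (y S) \<le> R"
    unfolding bounded_iff by blast
  with y that[of R] show ?thesis by fastforce
qed

lemma weight_eq_0_real:
  fixes ps :: "(int \<times> real set) list"
  assumes ps: "convex_comb ps" and zero: "\<And>t. lincomb ps t = 0"
  shows "weight ps = 0"
proof -
  obtain R where R: "\<And>S. S \<in> snd ` set ps \<Longrightarrow> S \<inter> cball 0 R \<noteq> {}"
    using convex_comb_meets_cball[OF ps] by blast
  have "weight (map (apsnd (\<lambda>S. S \<inter> cball 0 R)) ps) = 0"
    by (rule weight_eq_0_real_compact)
      (use ps R in \<open>auto simp: lincomb_Int zero convex_comb_def image_iff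
        intro!: closed_Int_compact convex_Int\<close>)
  then show ?thesis by simp
qed

text \<open>Sets missed by the line are dropped, because \<open>convex_comb\<close> requires
  nonempty members. The weight of the result therefore counts exactly the sets that the line
  meets.\<close>

definition line_sections :: "'a::real_vector \<Rightarrow> 'a \<Rightarrow> (int \<times> 'a set) list \<Rightarrow> (int \<times> real set) list" where
  "line_sections b x ps = map (apsnd (\<lambda>S. {t. x + t *\<^sub>R b \<in> S}))
     (filter (\<lambda>p. \<exists>t. x + t *\<^sub>R b \<in> snd p) ps)"

lemma lincomb_line_sections: "lincomb (line_sections b x ps) t = lincomb ps (x + t *\<^sub>R b)"
  by (induction ps) (auto simp: line_sections_def indicator_def)

text \<open>This lowers the dimension: read as a function of \<open>x\<close>, the weight on the
  line through \<open>x\<close> is the combination of the projections along \<open>b\<close>,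
  written as cylinders.\<close>

lemma weight_line_sections:
  "weight (line_sections b x ps) = lincomb (map (apsnd (\<lambda>S. {x. \<exists>t. x + t *\<^sub>R b \<in> S})) ps) x"
  by (induction ps) (auto simp: line_sections_def indicator_def)

lemma convex_line_section:
  fixes S :: "'a::real_vector set"
  assumes "convex S"
  shows "convex {t. x + t *\<^sub>R b \<in> S}"
proof (rule convexI)
  fix s t u v :: real
  assume st: "s \<in> {t. x + t *\<^sub>R b \<in> S}" "t \<in> {t. x + t *\<^sub>R b \<in> S}"
    and uv: "0 \<le> u" "0 \<le> v" "u + v = 1"
  have "u *\<^sub>R (x + s *\<^sub>R b) + v *\<^sub>R (x + t *\<^sub>R b) \<in> S"
    using st uv convexD[OF assms] by blast
  also have "u *\<^sub>R (x + s *\<^sub>R b) + v *\<^sub>R (x + t *\<^sub>R b) = (u + v) *\<^sub>R x + (u * s + v * t) *\<^sub>R b"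
    by (simp add: algebra_simps)
  finally show "u *\<^sub>R s + v *\<^sub>R t \<in> {t. x + t *\<^sub>R b \<in> S}"
    using uv by simp
qed

lemma convex_comb_line_sections:
  assumes "convex_comb ps"
  shows "convex_comb (line_sections b x ps)"
proof -
  have "closed {t. x + t *\<^sub>R b \<in> S}" if "closed S" for S
    using continuous_closed_vimage[OF that, of "\<lambda>t. x + t *\<^sub>R b"]
    by (simp add: vimage_def)
  then show ?thesis
    using assms by (auto simp: convex_comb_def line_sections_def convex_line_section)
qed

text \<open>Models projection along \<open>span B\<close> without leaving the space:
  \<open>S + span B\<close> is the preimage of the projected set.\<close>

abbreviation add_span :: "'a::euclidean_space set \<Rightarrow> (int \<times> 'a set) list \<Rightarrow> (int \<times> 'a set) list" where
  "add_span B ps \<equiv> map (apsnd (\<lambda>S. S + span B)) ps"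

text \<open>Vectors of \<open>span (insert b B)\<close> differ from vectors of \<open>span B\<close>
  by multiples of \<open>b\<close>. Hence projecting along one more direction adds one generator, as
  the inductions over a basis require.\<close>

lemma cylinder_span:
  fixes B S :: "'a::real_vector set"
  shows "{x. \<exists>t. x + t *\<^sub>R b \<in> S + span B} = S + span (insert b B)"
proof safe
  fix x t assume "x + t *\<^sub>R b \<in> S + span B"
  then obtain s u where su: "s \<in> S" "u \<in> span B" "x + t *\<^sub>R b = s + u"
    by (auto elim: set_plus_elim)
  then have "u - t *\<^sub>R b \<in> span (insert b B)"
    by (meson insertI1 span_base span_diff span_mono span_scale subset_insertI subsetD)
  moreover have "x = s + (u - t *\<^sub>R b)" using su by (simp add: algebra_simps)
  ultimately show "x \<in> S + span (insert b B)" using su by (auto intro: set_plus_intro)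
next
  fix x assume "x \<in> S + span (insert b B)"
  then obtain s u where su: "s \<in> S" "u \<in> span (insert b B)" "x = s + u"
    by (auto elim: set_plus_elim)
  then obtain k where "u - k *\<^sub>R b \<in> span B"
    by (auto simp: span_breakdown_eq)
  then have "s + (u - k *\<^sub>R b) \<in> S + span B" using su by (auto intro: set_plus_intro)
  then show "\<exists>t. x + t *\<^sub>R b \<in> S + span B"
    by (intro exI[of _ "-k"]) (simp add: su add_diff_eq)
qed

lemma weight_line_sections_add_span:
  "weight (line_sections b x (add_span B ps)) = lincomb (add_span (insert b B) ps) x"
  by (simp add: weight_line_sections o_def apsnd_def map_prod_def case_prod_unfold
      flip: cylinder_span)

text \<open>Compactness keeps the sums closed: a compact set plus a closed subspace is closed, while
  the sum of two closed sets may fail to be.\<close>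

lemma convex_comb_add_span:
  fixes B :: "'a::euclidean_space set"
  assumes "convex_comb ps" "\<forall>S\<in>snd ` set ps. compact S"
  shows "convex_comb (add_span B ps)"
proof -
  have "closed (S + span B)" if "compact S" for S
  proof -
    have "S + span B = (\<Union>x\<in>S. \<Union>y\<in>span B. {x + y})"
      by (auto simp: set_plus_def)
    then show ?thesis
      using compact_closed_sums[OF that closed_subspace[OF subspace_span[of B]]] by simp
  qed
  moreover have "convex (S + span B)" if "convex S" for S
    using that by (simp add: convex_set_plus subspace_imp_convex)
  moreover have "S + span B \<noteq> {}" if "S \<noteq> {}" for S
    using that span_zero[of B] by (auto simp: set_plus_def)
  ultimately show ?thesis
    using assms by (auto simp: convex_comb_def)
qed

lemma add_span_empty [simp]: "add_span {} ps = ps"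
proof -
  have "(\<lambda>S. S + span {}) = (id :: 'a set \<Rightarrow> 'a set)"
    by (auto simp: set_plus_def)
  then show ?thesis by (simp add: apsnd_def map_prod.id)
qed

text \<open>Once every direction has been projected away, each nonempty set has become the whole
  space.\<close>

lemma lincomb_add_span_UNIV:
  assumes "span B = UNIV" "convex_comb ps"
  shows "lincomb (add_span B ps) x = weight ps"
proof -
  have "S + UNIV = UNIV" if ne: "S \<noteq> {}" for S :: "'a set"
  proof -
    obtain s where "s \<in> S" using ne by blast
    then have "s + (y - s) \<in> S + UNIV" for y by blast
    then show ?thesis by auto
  qed
  then show ?thesis
    using assms by (induction ps) auto
qed

lemma weight_eq_0:
  fixes ps :: "(int \<times> 'a::euclidean_space set) list"
  assumes ps: "convex_comb ps" and zero: "\<And>x. lincomb ps x = 0"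
  shows "weight ps = 0"
proof -
  obtain R where R: "\<And>S. S \<in> snd ` set ps \<Longrightarrow> S \<inter> cball 0 R \<noteq> {}"
    using convex_comb_meets_cball[OF ps] by blast
  define qs where "qs = map (apsnd (\<lambda>S. S \<inter> cball 0 R)) ps"
  have qs: "convex_comb qs" "\<forall>S\<in>snd ` set qs. compact S"
    using ps R by (auto simp: qs_def convex_comb_def image_iff intro!: convex_Int)
  \<comment> \<open>Induction over the directions: the next combination at \<open>x\<close> is the
    weight of the previous one on the line through \<open>x\<close>, where it vanishes, so the case
    of the real line applies.\<close>
  have "lincomb (add_span B qs) x = 0" if "finite B" for B x
    using that
  proof (induction B arbitrary: x)
    case empty
    then show ?case unfolding add_span_empty by (simp add: qs_def lincomb_Int zero)
  next
    case (insert b B)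
    have "weight (line_sections b x (add_span B qs)) = 0"
      by (intro weight_eq_0_real convex_comb_line_sections convex_comb_add_span qs)
        (simp add: lincomb_line_sections insert.IH)
    then show ?case by (simp add: weight_line_sections_add_span)
  qed
  then have "weight qs = 0"
    using lincomb_add_span_UNIV[OF span_Basis qs(1)] by (metis finite_Basis)
  then show ?thesis by (simp add: qs_def)
qed

section \<open>The Euler functional\<close>

definition euler_functions :: "('a::euclidean_space \<Rightarrow> int) set" where
  "euler_functions = {lincomb ps |ps. convex_comb ps}"

definition chi :: "('a::euclidean_space \<Rightarrow> int) \<Rightarrow> int" where
  "chi f = (THE k. \<exists>ps. convex_comb ps \<and> f = lincomb ps \<and> k = weight ps)"

text \<open>\<open>chi\<close> is well defined: two representations of one function differ by a
  combination that vanishes everywhere, and \<open>weight_eq_0\<close> forces equal weights.\<close>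

lemma chi_lincomb:
  assumes "convex_comb ps"
  shows "chi (lincomb ps) = weight ps"
  unfolding chi_def
proof (rule the_equality)
  show "\<exists>qs. convex_comb qs \<and> lincomb ps = lincomb qs \<and> weight ps = weight qs"
    using assms by blast
next
  fix k assume "\<exists>qs. convex_comb qs \<and> lincomb ps = lincomb qs \<and> k = weight qs"
  then obtain qs where qs: "convex_comb qs" "lincomb ps = lincomb qs" "k = weight qs"
    by blast
  have "weight (ps @ map (apfst ((*) (-1))) qs) = 0"
  proof (rule weight_eq_0)
    show "convex_comb (ps @ map (apfst ((*) (-1))) qs)"
      using assms qs(1) by (simp only: convex_comb_simps convex_comb_scale)
    show "lincomb (ps @ map (apfst ((*) (-1))) qs) x = 0" for x
      by (simp only: lincomb_simps lincomb_scale qs(2))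
  qed
  then show "k = weight ps" by (simp only: weight_simps weight_scale qs(3))
qed

lemma euler_functionsI: "convex_comb ps \<Longrightarrow> (\<And>x. f x = lincomb ps x) \<Longrightarrow> f \<in> euler_functions"
  unfolding euler_functions_def by blast

lemma chi_eqI: "convex_comb ps \<Longrightarrow> (\<And>x. f x = lincomb ps x) \<Longrightarrow> weight ps = k \<Longrightarrow> chi f = k"
  using chi_lincomb[of ps] by presburger

lemma euler_functionsE:
  assumes "f \<in> euler_functions"
  obtains ps where "convex_comb ps" "f = lincomb ps" "chi f = weight ps"
  using assms chi_lincomb unfolding euler_functions_def by blast

lemma euler_functions_zero [simp]: "(\<lambda>x. 0) \<in> euler_functions"
  and chi_zero [simp]: "chi (\<lambda>x. 0) = 0"
  by (auto intro: euler_functionsI[of "[]"] chi_eqI[of "[]"])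

lemma euler_functions_indicator:
  assumes "closed S" "convex S"
  shows "indicator S \<in> euler_functions"
proof (cases "S = {}")
  case True
  then have "indicator S = (\<lambda>x. 0 :: int)" by auto
  then show ?thesis by simp
next
  case False
  then show ?thesis using assms by (intro euler_functionsI[of "[(1, S)]"]) auto
qed

lemma chi_indicator:
  assumes "closed S" "convex S" "S \<noteq> {}"
  shows "chi (indicator S) = 1"
  using assms by (intro chi_eqI[of "[(1, S)]"]) auto

lemma
  assumes "f \<in> euler_functions" "g \<in> euler_functions"
  shows euler_functions_add: "(\<lambda>x. f x + g x) \<in> euler_functions"
    and chi_add: "chi (\<lambda>x. f x + g x) = chi f + chi g"
proof -
  obtain ps where ps: "convex_comb ps" "f = lincomb ps" "chi f = weight ps"
    using euler_functionsE[OF assms(1)] by blast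
  obtain qs where qs: "convex_comb qs" "g = lincomb qs" "chi g = weight qs"
    using euler_functionsE[OF assms(2)] by blast
  show "(\<lambda>x. f x + g x) \<in> euler_functions"
    by (rule euler_functionsI[of "ps @ qs"]) (use ps qs in auto)
  show "chi (\<lambda>x. f x + g x) = chi f + chi g"
    by (rule chi_eqI[of "ps @ qs"]) (use ps qs in auto)
qed

lemma
  assumes "f \<in> euler_functions"
  shows euler_functions_scale: "(\<lambda>x. c * f x) \<in> euler_functions"
    and chi_scale: "chi (\<lambda>x. c * f x) = c * chi f"
proof -
  obtain ps where ps: "convex_comb ps" "f = lincomb ps" "chi f = weight ps"
    using euler_functionsE[OF assms] by blast
  show "(\<lambda>x. c * f x) \<in> euler_functions"
    by (rule euler_functionsI[of "map (apfst ((*) c)) ps"]) (use ps in auto)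
  show "chi (\<lambda>x. c * f x) = c * chi f"
    by (rule chi_eqI[of "map (apfst ((*) c)) ps"]) (use ps in auto)
qed

lemma euler_functions_diff:
  assumes "f \<in> euler_functions" "g \<in> euler_functions"
  shows "(\<lambda>x. f x - g x) \<in> euler_functions"
  using euler_functions_add[OF assms(1) euler_functions_scale[OF assms(2), of "-1"]] by simp

lemma
  assumes "finite I" "\<And>i. i \<in> I \<Longrightarrow> f i \<in> euler_functions"
  shows euler_functions_sum: "(\<lambda>x. \<Sum>i\<in>I. f i x) \<in> euler_functions"
    and chi_sum: "chi (\<lambda>x. \<Sum>i\<in>I. f i x) = (\<Sum>i\<in>I. chi (f i))"
proof -
  have "(\<lambda>x. \<Sum>i\<in>I. f i x) \<in> euler_functions \<and> chi (\<lambda>x. \<Sum>i\<in>I. f i x) = (\<Sum>i\<in>I. chi (f i))"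
    using assms by (induction I) (simp_all add: chi_add euler_functions_add)
  then show "(\<lambda>x. \<Sum>i\<in>I. f i x) \<in> euler_functions"
    "chi (\<lambda>x. \<Sum>i\<in>I. f i x) = (\<Sum>i\<in>I. chi (f i))" by auto
qed

lemma euler_functions_Int_closed:
  assumes "f \<in> euler_functions" "closed S" "convex S"
  shows "(\<lambda>x. f x * indicator S x) \<in> euler_functions"
proof -
  obtain ps where ps: "convex_comb ps" "f = lincomb ps"
    using euler_functionsE[OF assms(1)] by blast
  have "convex_comb ps \<Longrightarrow> (\<lambda>x. lincomb ps x * indicator S x) \<in> euler_functions" for ps
  proof (induction ps)
    case (Cons p ps)
    obtain n T where p: "p = (n, T)" by force
    have "(\<lambda>x. n * indicator (T \<inter> S) x + lincomb ps x * indicator S x) \<in> euler_functions"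
      using Cons p assms
      by (intro euler_functions_add euler_functions_scale euler_functions_indicator closed_Int convex_Int) auto
    also have "(\<lambda>x. n * indicator (T \<inter> S) x + lincomb ps x * indicator S x) =
        (\<lambda>x. lincomb (p # ps) x * indicator S x)"
      by (auto simp: p algebra_simps indicator_def)
    finally show ?case .
  qed simp
  with ps show ?thesis by simp
qed

lemma euler_functions_mult:
  assumes "f \<in> euler_functions" "g \<in> euler_functions"
  shows "(\<lambda>x. f x * g x) \<in> euler_functions"
proof -
  obtain ps where ps: "convex_comb ps" "g = lincomb ps"
    using euler_functionsE[OF assms(2)] by blast
  have "convex_comb ps \<Longrightarrow> (\<lambda>x. f x * lincomb ps x) \<in> euler_functions" for ps
  proof (induction ps)
    case (Cons p ps)
    obtain n T where p: "p = (n, T)" by force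
    have "(\<lambda>x. n * (f x * indicator T x) + f x * lincomb ps x) \<in> euler_functions"
      using Cons p assms
      by (intro euler_functions_add euler_functions_scale euler_functions_Int_closed) auto
    also have "(\<lambda>x. n * (f x * indicator T x) + f x * lincomb ps x) =
        (\<lambda>x. f x * lincomb (p # ps) x)"
      by (auto simp: p algebra_simps)
    finally show ?case .
  qed simp
  with ps show ?thesis by simp
qed

text \<open>Cutting every set with a ball that contains the support leaves \<open>f\<close>
  unchanged. Sets that become empty are filtered out, since their indicators contribute
  nothing.\<close>

lemma euler_functions_compactE:
  assumes f: "f \<in> euler_functions" and bdd: "bounded {x. f x \<noteq> 0}"
  obtains ps where "convex_comb ps" "\<forall>S\<in>snd ` set ps. compact S" "f = lincomb ps" "chi f = weight ps"
proof -
  obtain qs where qs: "convex_comb qs" "f = lincomb qs"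
    using euler_functionsE[OF f] by blast
  obtain R where R: "\<And>x. f x \<noteq> 0 \<Longrightarrow> norm x \<le> R"
    using bdd unfolding bounded_iff by blast
  define ps where "ps = filter (\<lambda>p. snd p \<noteq> {}) (map (apsnd (\<lambda>S. S \<inter> cball 0 R)) qs)"
  have "lincomb ps x = lincomb (map (apsnd (\<lambda>S. S \<inter> cball 0 R)) qs) x" for x
    unfolding ps_def by (induction qs) auto
  also have "\<dots> x = f x" for x
    using R[of x] by (auto simp: lincomb_Int qs(2) indicator_def)
  finally have "f = lincomb ps" by auto
  moreover have "convex_comb ps" "\<forall>S\<in>snd ` set ps. compact S"
    using qs(1) unfolding ps_def convex_comb_def
    by (fastforce intro: convex_Int closed_Int closed_Int_compact)+
  ultimately show ?thesis using that chi_lincomb by blast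
qed

text \<open>A Fubini argument in one direction: projecting along \<open>b\<close> keeps the weight,
  and the projection takes at \<open>x\<close> the value of \<open>chi\<close> on the line through
  \<open>x\<close>.\<close>

lemma chi_eq_0_lines:
  assumes f: "f \<in> euler_functions" "bounded {x. f x \<noteq> 0}"
    and lines: "\<And>x. chi (\<lambda>t::real. f (x + t *\<^sub>R b)) = 0"
  shows "chi f = 0"
proof -
  obtain ps where ps: "convex_comb ps" "\<forall>S\<in>snd ` set ps. compact S" "f = lincomb ps" "chi f = weight ps"
    using euler_functions_compactE[OF f] by blast
  have "lincomb (add_span {b} ps) x = weight (line_sections b x (add_span {} ps))" for x
    by (rule weight_line_sections_add_span[symmetric])
  also have "\<dots> x = chi (\<lambda>t::real. f (x + t *\<^sub>R b))" for x
    by (rule chi_eqI[symmetric, OF convex_comb_line_sections])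
      (simp_all only: add_span_empty ps lincomb_line_sections)
  finally have "weight (add_span {b} ps) = 0"
    using convex_comb_add_span[OF ps(1,2)] lines by (intro weight_eq_0) auto
  then show ?thesis using ps(4) by simp
qed

section \<open>Intervals and relatively open convex sets\<close>

lemma chi_half_open_interval:
  fixes p q :: real
  assumes "p < q"
  shows "chi (indicator {p<..q}) = 0"
  by (rule chi_eqI[of "[(1, {p..q}), (-1, {p})]"]) (use assms in \<open>auto simp: indicator_def\<close>)

lemma
  fixes p q :: real
  assumes "p < q"
  shows euler_functions_open_interval: "indicator {p<..<q} \<in> euler_functions"
    and chi_open_interval: "chi (indicator {p<..<q}) = -1"
proof -
  let ?ps = "[(1, {p..q}), (-1, {p}), (-1, {q})]"
  have "convex_comb ?ps" "indicator {p<..<q} x = lincomb ?ps x" for x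
    using assms by (auto simp: indicator_def)
  then show "indicator {p<..<q} \<in> euler_functions" "chi (indicator {p<..<q}) = -1"
    by (auto intro: euler_functionsI[of ?ps] chi_eqI[of ?ps])
qed

lemma open_convex_bounded_realE:
  fixes J :: "real set"
  assumes "open J" "convex J" "bounded J" "J \<noteq> {}"
  obtains p q where "p < q" "J = {p<..<q}"
proof -
  have bdd: "bdd_above J" "bdd_below J"
    using assms(3) bounded_imp_bdd_above bounded_imp_bdd_below by auto
  have sub: "Inf J < t" "t < Sup J" if t: "t \<in> J" for t
  proof -
    obtain e where e: "e > 0" "cball t e \<subseteq> J"
      using assms(1) open_contains_cball t by blast
    then have "t - e \<in> J" "t + e \<in> J" by (auto simp: subset_iff dist_real_def)
    then have "Inf J \<le> t - e" "t + e \<le> Sup J"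
      using bdd cInf_lower cSup_upper by auto
    then show "Inf J < t" "t < Sup J" using e by auto
  qed
  have sup: "t \<in> J" if t: "Inf J < t" "t < Sup J" for t
  proof -
    obtain r s where "r \<in> J" "s \<in> J" "r < t" "t < s"
      using t cInf_less_iff[OF assms(4) bdd(2)] less_cSup_iff[OF assms(4) bdd(1)] by blast
    moreover have "is_interval J" using assms(2) by (simp add: is_interval_convex_1)
    ultimately show "t \<in> J"
      using mem_is_interval_1_I[of J r s t] by simp
  qed
  obtain t where "t \<in> J" using assms(4) by blast
  then have "Inf J < Sup J" using sub[of t] by linarith
  moreover have "J = {Inf J<..<Sup J}"
    using sub sup by (intro equalityI subsetI) auto
  ultimately show ?thesis by (rule that)
qed

lemma
  fixes J :: "real set"
  assumes "open J" "convex J" "bounded J"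
  shows euler_functions_open_convex_real: "indicator J \<in> euler_functions"
    and chi_open_convex_real: "chi (indicator J) = (if J = {} then 0 else -1)"
proof -
  have "indicator J \<in> euler_functions \<and> chi (indicator J) = (if J = {} then 0 else -1)"
  proof (cases "J = {}")
    case True
    then have "indicator J = (\<lambda>t::real. 0 :: int)" by auto
    then show ?thesis using True by simp
  next
    case False
    then obtain p q where "p < q" "J = {p<..<q}"
      using open_convex_bounded_realE[OF assms] by blast
    then show ?thesis using euler_functions_open_interval chi_open_interval by simp
  qed
  then show "indicator J \<in> euler_functions" "chi (indicator J) = (if J = {} then 0 else -1)"
    by auto
qed

text \<open>Adding the span of one more vector of an orthogonal basis of the direction space of \<open>U\<close>
  changes the sign, because the lines in that direction meet \<open>U\<close> plus the earlier span in open
  intervals. At the end \<open>U\<close> has become its affine hull.\<close>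

lemma chi_rel_open_convex:
  fixes U :: "'a::euclidean_space set"
  assumes U: "convex U" "bounded U" "U \<noteq> {}" "rel_interior U = U"
    and f: "indicator U \<in> euler_functions"
  shows "chi (indicator U) = (-1) ^ nat (aff_dim U)"
proof -
  have "bounded {x. indicator U x \<noteq> (0::int)}" using U(2) by (simp add: indicator_def)
  then obtain ps where ps: "convex_comb ps" "\<forall>S\<in>snd ` set ps. compact S"
      "(indicator U :: 'a \<Rightarrow> int) = lincomb ps" "chi (indicator U) = weight ps"
    using euler_functions_compactE[OF f] by blast
  obtain a where a: "a \<in> U" using U(3) by auto
  define L where "L = span ((\<lambda>x. x - a) ` U)"
  have L: "(\<lambda>x. x - a) ` (affine hull U) = L"
    unfolding L_def by (rule diffs_affine_hull_span[OF a])
  have dimL: "aff_dim U = int (dim L)"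
    using a aff_dim_eq_dim_subtract[of a U] by (simp add: L_def hull_inc)
  \<comment> \<open>Orthogonality makes each new vector perpendicular to the span of the earlier
    ones; this is what bounds the sections \<open>J\<close> below.\<close>
  obtain B0 where B0: "0 \<notin> B0" "B0 \<subseteq> L" "pairwise orthogonal B0" "independent B0"
      "card B0 = dim L" "span B0 = L"
    using orthogonal_basis_subspace[of L] subspace_span unfolding L_def by blast
  have addL: "x + y \<in> affine hull U" if "x \<in> affine hull U" "y \<in> L" for x y
  proof -
    have "x - a \<in> L" using that L by blast
    then have "(x - a) + y \<in> L" using that by (simp add: L_def span_add)
    then obtain z where "z \<in> affine hull U" "x - a + y = z - a" using L by blast
    then show ?thesis by (simp add: algebra_simps)
  qed
  have U_L: "U + L = affine hull U"
  proof (intro equalityI subsetI)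
    fix x assume "x \<in> U + L"
    then show "x \<in> affine hull U" using addL hull_subset[of U affine] by (auto elim!: set_plus_elim)
  next
    fix x assume "x \<in> affine hull U"
    then have "a + (x - a) \<in> U + L" using a L by (intro set_plus_intro) auto
    then show "x \<in> U + L" by simp
  qed
  have main: "lincomb (add_span B ps) x = (-1) ^ card B * indicator (U + span B) x"
    if "finite B" "B \<subseteq> B0" for B x
    using that
  proof (induction B arbitrary: x)
    case empty
    have "U + {0} = U" by (auto simp: set_plus_def)
    then show ?case unfolding add_span_empty using ps(3) by simp
  next
    case (insert b B)
    define J where "J = {t. x + t *\<^sub>R b \<in> U + span B}"
    have b: "b \<in> L" "b \<noteq> 0" using insert.prems B0 by auto
    have orth: "b \<bullet> s = 0" if "s \<in> span B" for s
    proof -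
      have "orthogonal b y" if "y \<in> B" for y
        using that insert.prems insert.hyps by (intro pairwiseD[OF B0(3)]) auto
      then show ?thesis using orthogonal_to_span[OF that] by (simp add: orthogonal_def)
    qed
    \<comment> \<open>Since \<open>U\<close> is relatively open, \<open>u\<close> can be moved a
      little along \<open>b\<close> inside \<open>U\<close>, while the summand \<open>s\<close> is
      kept.\<close>
    have "open J"
      unfolding open_contains_ball
    proof
      fix t assume "t \<in> J"
      then obtain u s where us: "u \<in> U" "s \<in> span B" "x + t *\<^sub>R b = u + s"
        by (auto simp: J_def elim: set_plus_elim)
      obtain e where e: "e > 0" "ball u e \<inter> affine hull U \<subseteq> U"
        using us(1) U(4) mem_rel_interior_ball[of u U] by auto
      have "r \<in> J" if "r \<in> ball t (e / norm b)" for r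
      proof -
        have "norm ((r - t) *\<^sub>R b) < e"
          using that b by (simp add: dist_real_def pos_less_divide_eq abs_minus_commute)
        moreover have "(r - t) *\<^sub>R b \<in> L" using b by (simp add: L_def span_scale)
        ultimately have "u + (r - t) *\<^sub>R b \<in> ball u e \<inter> affine hull U"
          using addL[OF hull_inc[OF us(1)]] by (simp add: dist_norm)
        then have "u + (r - t) *\<^sub>R b \<in> U" using e(2) by blast
        then have "(u + (r - t) *\<^sub>R b) + s \<in> U + span B" using us by (intro set_plus_intro)
        also have "(u + (r - t) *\<^sub>R b) + s = x + r *\<^sub>R b"
          using us(3) by (simp add: algebra_simps)
        finally show ?thesis by (simp add: J_def)
      qed
      then show "\<exists>e>0. ball t e \<subseteq> J" using e b
        by (intro exI[of _ "e / norm b"]) auto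
    qed
    moreover have "convex J"
    proof -
      have "convex (U + span B)" using U by (simp add: convex_set_plus subspace_imp_convex)
      then show ?thesis unfolding J_def by (rule convex_line_section)
    qed
    moreover have "bounded J"
    proof -
      obtain M where M: "\<And>u. u \<in> U \<Longrightarrow> norm u \<le> M"
        using U(2) unfolding bounded_iff by blast
      \<comment> \<open>The inner product with \<open>b\<close> removes the summand from
        \<open>span B\<close>, so \<open>t\<close> is controlled by the bounded summand
        \<open>u\<close>.\<close>
      have "norm t \<le> (norm b * M + \<bar>b \<bullet> x\<bar>) / (b \<bullet> b)" if t: "t \<in> J" for t
      proof -
        obtain u s where us: "u \<in> U" "s \<in> span B" "x + t *\<^sub>R b = u + s"
          using t by (auto simp: J_def elim: set_plus_elim)
        have "b \<bullet> (x + t *\<^sub>R b) = b \<bullet> u" using us orth by (simp add: inner_add_right)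
        then have "t * (b \<bullet> b) = b \<bullet> u - b \<bullet> x" by (simp add: inner_add_right)
        then have "\<bar>t\<bar> * (b \<bullet> b) = \<bar>b \<bullet> u - b \<bullet> x\<bar>"
          by (metis abs_mult abs_of_nonneg inner_ge_zero)
        also have "\<dots> \<le> norm b * norm u + \<bar>b \<bullet> x\<bar>"
          using Cauchy_Schwarz_ineq2[of b u] by linarith
        also have "\<dots> \<le> norm b * M + \<bar>b \<bullet> x\<bar>"
          using M[OF us(1)] by (simp add: mult_left_mono)
        finally show ?thesis using b by (simp add: pos_le_divide_eq)
      qed
      then show ?thesis unfolding bounded_iff by blast
    qed
    ultimately have indJ: "indicator J \<in> euler_functions"
      and chiJ: "chi (indicator J) = (if J = {} then 0 else -1)"
      by (rule euler_functions_open_convex_real, rule chi_open_convex_real)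
    have emp: "J = {} \<longleftrightarrow> x \<notin> U + span (insert b B)"
      unfolding J_def cylinder_span[symmetric] by auto
    define qs where "qs = line_sections b x (add_span B ps)"
    have qs: "convex_comb qs"
      unfolding qs_def by (intro convex_comb_line_sections convex_comb_add_span ps)
    have lq: "lincomb qs = (\<lambda>t. (-1) ^ card B * indicator J t)"
      using insert.IH insert.prems
      by (intro ext) (simp add: qs_def lincomb_line_sections J_def indicator_def)
    have weq: "weight qs = chi (lincomb qs)" by (simp add: chi_lincomb qs)
    have "weight qs = (-1) ^ card B * (if J = {} then 0 else -1)"
      unfolding weq lq chi_scale[OF indJ] chiJ by simp
    then show ?case
      using insert.hyps emp unfolding qs_def weight_line_sections_add_span
      by (simp add: indicator_def)
  qed
  \<comment> \<open>For the full basis the sum \<open>U + span B0\<close> is the affine hull, a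
    closed convex set. Adding spans never changes weights, so this determines
    \<open>weight ps\<close>.\<close>
  have "weight (add_span B0 ps) = (-1) ^ card B0 * chi (indicator (affine hull U))"
  proof -
    have "weight (add_span B0 ps) = chi (lincomb (add_span B0 ps))"
      by (rule chi_lincomb[symmetric]) (intro convex_comb_add_span ps)
    also have "lincomb (add_span B0 ps) = (\<lambda>x. (-1) ^ card B0 * indicator (affine hull U) x)"
      using main[OF independent_imp_finite[OF B0(4)]] by (auto simp: B0 U_L)
    finally show ?thesis by (simp add: chi_scale euler_functions_indicator)
  qed
  moreover have "chi (indicator (affine hull U)) = 1"
    using U by (intro chi_indicator) auto
  ultimately show ?thesis by (simp add: ps(4) dimL B0)
qed

section \<open>The half-space ring and its Euler measure\<close>

lemma ring_of_sets_halfspace_ring: "ring_of_sets UNIV halfspace_ring"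
  unfolding ring_of_sets_iff halfspace_ring_def by blast

lemma halfspace_ring_minimal:
  assumes "S \<in> halfspace_ring" "ring_of_sets UNIV M" "\<And>a b. a \<noteq> 0 \<Longrightarrow> {x. a \<bullet> x \<le> b} \<in> M"
  shows "S \<in> M"
  using assms unfolding halfspace_ring_def by blast

interpretation halfspace_ring: ring_of_sets UNIV "halfspace_ring :: 'a::euclidean_space set set"
  by (rule ring_of_sets_halfspace_ring)

lemma halfspace_in_halfspace_ring: "a \<noteq> 0 \<Longrightarrow> {x. a \<bullet> x \<le> b} \<in> halfspace_ring"
  unfolding halfspace_ring_def by blast

lemma UNIV_in_halfspace_ring [simp]: "UNIV \<in> (halfspace_ring :: 'a::euclidean_space set set)"
proof -
  obtain a :: 'a where "a \<noteq> 0" using nonzero_Basis nonempty_Basis by blast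
  then have "{x. a \<bullet> x \<le> 0} \<union> {x. (-a) \<bullet> x \<le> 0} \<in> halfspace_ring"
    by (intro halfspace_ring.Un halfspace_in_halfspace_ring) auto
  also have "{x. a \<bullet> x \<le> 0} \<union> {x. (-a) \<bullet> x \<le> 0} = UNIV" by auto
  finally show ?thesis .
qed

lemma polyhedron_in_halfspace_ring:
  assumes "polyhedron S"
  shows "S \<in> halfspace_ring"
proof -
  obtain F where F: "finite F" "S = \<Inter>F" "\<forall>h\<in>F. \<exists>a b. a \<noteq> 0 \<and> h = {x. a \<bullet> x \<le> b}"
    using assms unfolding polyhedron_def by blast
  have "\<Inter>F \<in> halfspace_ring"
    using F(1,3)
  proof (induction F)
    case (insert h F)
    then have "h \<in> halfspace_ring" using halfspace_in_halfspace_ring by auto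
    with insert show ?case by (simp add: halfspace_ring.Int)
  qed simp
  with F show ?thesis by simp
qed

text \<open>The relative frontier of a polyhedron is the union of its finitely many proper faces,
  which are polyhedra themselves.\<close>

lemma rel_interior_in_halfspace_ring:
  assumes "polyhedron S"
  shows "rel_interior S \<in> halfspace_ring"
proof -
  have "\<Union>{F. F face_of S \<and> F \<noteq> S} \<in> halfspace_ring"
    using assms finite_polyhedron_faces[OF assms]
    by (intro halfspace_ring.finite_Union)
      (auto intro: polyhedron_in_halfspace_ring face_of_polyhedron_polyhedron rev_finite_subset)
  then have "rel_frontier S \<in> halfspace_ring"
    using rel_frontier_of_polyhedron_alt[OF assms] by simp
  then have "S - rel_frontier S \<in> halfspace_ring"
    using assms polyhedron_in_halfspace_ring by blast
  also have "S - rel_frontier S = rel_interior S"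
    using rel_interior_subset[of S] polyhedron_imp_closed[OF assms]
    by (auto simp: rel_frontier_def)
  finally show ?thesis .
qed

text \<open>Since Euler functions are closed under linear combinations and products, the sets whose
  indicators are Euler functions form a ring, and it contains the closed half-spaces.\<close>

lemma halfspace_ring_indicator:
  assumes "S \<in> halfspace_ring"
  shows "indicator S \<in> euler_functions"
proof -
  let ?M = "{S. indicator S \<in> (euler_functions :: ('a \<Rightarrow> int) set)}"
  have "S \<in> ?M"
  proof (rule halfspace_ring_minimal[OF assms])
    show "ring_of_sets UNIV ?M"
    proof (rule ring_of_setsI)
      have "indicator {} = (\<lambda>x::'a. 0 :: int)" by auto
      then show "{} \<in> ?M" by simp
    next
      fix S T assume ST: "S \<in> ?M" "T \<in> ?M"
      have "indicator (S \<union> T) = (\<lambda>x. (indicator S x :: int) + indicator T x - indicator S x * indicator T x)"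
        by (auto simp: indicator_def)
      then show "S \<union> T \<in> ?M"
        using ST by (simp add: euler_functions_diff euler_functions_add euler_functions_mult)
      have "indicator (S - T) = (\<lambda>x. (indicator S x :: int) - indicator S x * indicator T x)"
        by (auto simp: indicator_def)
      then show "S - T \<in> ?M"
        using ST by (simp add: euler_functions_diff euler_functions_mult)
    qed auto
    show "{x. a \<bullet> x \<le> b} \<in> ?M" for a :: 'a and b
      using euler_functions_indicator[OF closed_halfspace_le convex_halfspace_le] by simp
  qed
  then show ?thesis by simp
qed

section \<open>Cells of hyperplane arrangements\<close>

definition sign_cell :: "('a::euclidean_space \<times> real) set \<Rightarrow> 'a \<Rightarrow> 'a set" where
  "sign_cell H x = {y. \<forall>(a, b)\<in>H. sgn (a \<bullet> y - b) = sgn (a \<bullet> x - b)}"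

text \<open>A pair \<open>(a, b)\<close> encodes the affine function
  \<open>a \<bullet> y - b\<close>. Allowing the value 0 besides the sign at \<open>x\<close>
  describes the closure of the sign cell by weak inequalities and equations.\<close>

definition closed_cell :: "('a::euclidean_space \<times> real) set \<Rightarrow> 'a \<Rightarrow> 'a set" where
  "closed_cell H x = {y. \<forall>(a, b)\<in>H. sgn (a \<bullet> y - b) \<in> {0, sgn (a \<bullet> x - b)}}"

lemma mem_sign_cell [simp]: "x \<in> sign_cell H x"
  and mem_closed_cell [simp]: "x \<in> closed_cell H x"
  by (auto simp: sign_cell_def closed_cell_def)

text \<open>Sets that are unions of cells of some finite arrangement form a ring, because the union
  of two arrangements refines both.\<close>

lemma halfspace_ring_sign_cells:
  assumes "S \<in> halfspace_ring"
  obtains H where "finite H" "\<And>x y. y \<in> sign_cell H x \<Longrightarrow> y \<in> S \<longleftrightarrow> x \<in> S"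
proof -
  let ?P = "\<lambda>(S :: 'a set) H. finite H \<and> (\<forall>x y. y \<in> sign_cell H x \<longrightarrow> (y \<in> S \<longleftrightarrow> x \<in> S))"
  have sub: "y \<in> sign_cell H x \<and> y \<in> sign_cell K x" if "y \<in> sign_cell (H \<union> K) x"
    for x y :: 'a and H K using that by (auto simp: sign_cell_def)
  have "S \<in> {S. \<exists>H. ?P S H}"
  proof (rule halfspace_ring_minimal[OF assms])
    show "ring_of_sets UNIV {S. \<exists>H. ?P S H}"
    proof (rule ring_of_setsI)
      fix S T assume "S \<in> {S. \<exists>H. ?P S H}" "T \<in> {S. \<exists>H. ?P S H}"
      then obtain H K where "?P S H" "?P T K" by blast
      then have "?P (S \<union> T) (H \<union> K)" "?P (S - T) (H \<union> K)"
        using sub by (blast+)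
      then show "S \<union> T \<in> {S. \<exists>H. ?P S H}" "S - T \<in> {S. \<exists>H. ?P S H}" by blast+
    qed (auto intro: exI[of _ "{}"])
    show "{x. a \<bullet> x \<le> b} \<in> {S. \<exists>H. ?P S H}" for a :: 'a and b
      by (auto intro!: exI[of _ "{(a, b)}"] simp: sign_cell_def sgn_if split: if_splits)
  qed
  then show ?thesis using that by blast
qed

text \<open>Moving from \<open>y\<close> slightly towards \<open>x\<close> gives every affine
  function in \<open>H\<close> the sign it has at \<open>x\<close>, as its value at \<open>y\<close>
  is zero or has that sign already.\<close>

lemma closed_cell_subset_closure: "closed_cell H x \<subseteq> closure (sign_cell H x)"
proof
  fix y assume y: "y \<in> closed_cell H x"
  define z where "z n = y + inverse (real (Suc n)) *\<^sub>R (x - y)" for n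
  have "z n \<in> sign_cell H x" for n
    unfolding sign_cell_def
  proof clarsimp
    fix a b assume ab: "(a, b) \<in> H"
    define t where "t = inverse (real (Suc n))"
    have t: "0 < t" "t \<le> 1" by (simp_all add: t_def inverse_le_1_iff)
    have "a \<bullet> z n - b = (1 - t) * (a \<bullet> y - b) + t * (a \<bullet> x - b)"
      unfolding z_def t_def[symmetric] by (simp add: algebra_simps)
    moreover have "sgn (a \<bullet> y - b) \<in> {0, sgn (a \<bullet> x - b)}"
      using y ab by (auto simp: closed_cell_def)
    moreover have "sgn ((1 - t) * u + t * v) = sgn v" if "sgn u \<in> {0, sgn v}" for u v :: real
    proof (cases v "0::real" rule: linorder_cases)
      case less
      then have "u \<le> 0" using that by (auto simp: sgn_if split: if_splits)
      then have "(1 - t) * u \<le> 0" using t by (simp add: mult_nonneg_nonpos)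
      moreover have "t * v < 0" using t less by (simp add: mult_pos_neg)
      ultimately show ?thesis using less by simp
    next
      case greater
      then have "u \<ge> 0" using that by (auto simp: sgn_if split: if_splits)
      then have "(1 - t) * u \<ge> 0" using t by simp
      moreover have "t * v > 0" using t greater by simp
      ultimately show ?thesis using greater by simp
    qed (use that in \<open>auto simp: sgn_if split: if_splits\<close>)
    ultimately show "sgn (a \<bullet> z n - b) = sgn (a \<bullet> x - b)" by simp
  qed
  moreover have "z \<longlonglongrightarrow> y + 0 *\<^sub>R (x - y)"
    unfolding z_def by (intro tendsto_intros LIMSEQ_inverse_real_of_nat)
  ultimately show "y \<in> closure (sign_cell H x)"
    unfolding closure_sequential by auto
qed

lemma polyhedron_closed_cell:
  assumes "finite H"
  shows "polyhedron (closed_cell H x)"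
proof -
  have "polyhedron {y. sgn (a \<bullet> y - b) \<in> {0, sgn (a \<bullet> x - b)}}" for a b
  proof (cases "a \<bullet> x" b rule: linorder_cases)
    case less
    then have "{y. sgn (a \<bullet> y - b) \<in> {0, sgn (a \<bullet> x - b)}} = {y. a \<bullet> y \<le> b}"
      by (auto simp: sgn_if)
    then show ?thesis by (simp add: polyhedron_halfspace_le)
  next
    case equal
    then have "{y. sgn (a \<bullet> y - b) \<in> {0, sgn (a \<bullet> x - b)}} = {y. a \<bullet> y = b}"
      by (auto simp: sgn_if)
    then show ?thesis by (simp add: polyhedron_hyperplane)
  next
    case greater
    then have "{y. sgn (a \<bullet> y - b) \<in> {0, sgn (a \<bullet> x - b)}} = {y. a \<bullet> y \<ge> b}"
      by (auto simp: sgn_if)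
    then show ?thesis by (simp add: polyhedron_halfspace_ge)
  qed
  moreover have "closed_cell H x =
      \<Inter>((\<lambda>(a, b). {y. sgn (a \<bullet> y - b) \<in> {0, sgn (a \<bullet> x - b)}}) ` H)"
    by (auto simp: closed_cell_def)
  ultimately show ?thesis using assms by (auto intro!: polyhedron_Inter)
qed

text \<open>Both kinds of cell depend on \<open>x\<close> only through the vector of its signs, and
  there are finitely many such vectors.\<close>

lemma finite_cells:
  assumes "finite H"
  shows "finite (range (sign_cell H))" "finite (range (closed_cell H))"
proof -
  define \<sigma> where "\<sigma> x = (\<lambda>(a, b)\<in>H. sgn (a \<bullet> x - b))" for x :: 'a
  have "sgn u \<in> {-1, 0, 1}" for u :: real by (simp add: sgn_if)
  then have "range \<sigma> \<subseteq> (\<Pi>\<^sub>E h\<in>H. {-1, 0, 1})"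
    unfolding \<sigma>_def by fastforce
  then have fin: "finite (range \<sigma>)"
    using finite_PiE[OF assms, of "\<lambda>_. {-1, 0, 1::real}"] finite_subset by blast
  have eq: "sgn (a \<bullet> x - b) = \<sigma> x (a, b)" if "(a, b) \<in> H" for a b x
    using that by (simp add: \<sigma>_def)
  have "sign_cell H x = {y. \<forall>h\<in>H. \<sigma> y h = \<sigma> x h}" for x
    unfolding sign_cell_def using eq by fastforce
  then have "range (sign_cell H) = (\<lambda>s. {y. \<forall>h\<in>H. \<sigma> y h = s h}) ` range \<sigma>"
    by auto
  then show "finite (range (sign_cell H))" using fin by simp
  have "closed_cell H x = {y. \<forall>h\<in>H. \<sigma> y h \<in> {0, \<sigma> x h}}" for x
    unfolding closed_cell_def using eq by fastforce
  then have "range (closed_cell H) = (\<lambda>s. {y. \<forall>h\<in>H. \<sigma> y h \<in> {0, s h}}) ` range \<sigma>"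
    by auto
  then show "finite (range (closed_cell H))" using fin by simp
qed

text \<open>Where the signs at \<open>x\<close> and \<open>y\<close> differ, a common point can only
  have sign 0. So the intersection cuts the first cell by supporting hyperplanes, one for each pair
  in \<open>D\<close>.\<close>

lemma closed_cell_Int_face_of:
  assumes "finite H"
  shows "closed_cell H x \<inter> closed_cell H y face_of closed_cell H x"
proof -
  let ?Q = "closed_cell H x"
  define D where "D = {(a, b)\<in>H. sgn (a \<bullet> x - b) \<noteq> sgn (a \<bullet> y - b)}"
  have conv: "convex ?Q" by (simp add: assms polyhedron_closed_cell polyhedron_imp_convex)
  have face: "?Q \<inter> {z. a \<bullet> z = b} face_of ?Q" if "(a, b) \<in> H" for a b
  proof (cases "a \<bullet> x \<le> b")
    case True
    then have "a \<bullet> z \<le> b" if "z \<in> ?Q" for z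
      using that \<open>(a, b) \<in> H\<close> by (fastforce simp: closed_cell_def sgn_if split: if_splits)
    then show ?thesis by (intro face_of_Int_supporting_hyperplane_le conv)
  next
    case False
    then have "a \<bullet> z \<ge> b" if "z \<in> ?Q" for z
      using that \<open>(a, b) \<in> H\<close> by (fastforce simp: closed_cell_def sgn_if split: if_splits)
    then show ?thesis by (intro face_of_Int_supporting_hyperplane_ge conv)
  qed
  have "\<Inter>(insert ?Q ((\<lambda>(a, b). ?Q \<inter> {z. a \<bullet> z = b}) ` D)) face_of ?Q"
    by (rule face_of_Inter) (use face conv in \<open>auto simp: D_def face_of_refl\<close>)
  also have "\<Inter>(insert ?Q ((\<lambda>(a, b). ?Q \<inter> {z. a \<bullet> z = b}) ` D)) = ?Q \<inter> closed_cell H y"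
  proof (intro equalityI subsetI)
    fix z assume z: "z \<in> \<Inter>(insert ?Q ((\<lambda>(a, b). ?Q \<inter> {z. a \<bullet> z = b}) ` D))"
    have "sgn (a \<bullet> z - b) \<in> {0, sgn (a \<bullet> y - b)}" if "(a, b) \<in> H" for a b
      using z that by (cases "(a, b) \<in> D") (fastforce simp: D_def closed_cell_def)+
    with z show "z \<in> ?Q \<inter> closed_cell H y" by (auto simp: closed_cell_def)
  next
    fix z assume z: "z \<in> ?Q \<inter> closed_cell H y"
    then have "a \<bullet> z = b" if "(a, b) \<in> D" for a b
      using that by (fastforce simp: D_def closed_cell_def sgn_eq_0_iff)
    with z show "z \<in> \<Inter>(insert ?Q ((\<lambda>(a, b). ?Q \<inter> {z. a \<bullet> z = b}) ` D))" by auto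
  qed
  finally show ?thesis .
qed

text \<open>The closed cells of points of \<open>S\<close> form a cell complex and stay inside
  \<open>S\<close>, because \<open>S\<close> is closed and contains the corresponding sign cells. A
  simplicial subdivision does the rest.\<close>

lemma halfspace_ring_triangulation:
  assumes "S \<in> halfspace_ring" "closed S" "bounded S"
  obtains \<T> where "simplicial_complex \<T>" "\<Union>\<T> = S"
proof -
  obtain H where H: "finite H" "\<And>x y. y \<in> sign_cell H x \<Longrightarrow> y \<in> S \<longleftrightarrow> x \<in> S"
    using halfspace_ring_sign_cells[OF assms(1)] by blast
  have sub: "closed_cell H x \<subseteq> S" if "x \<in> S" for x
  proof -
    have "sign_cell H x \<subseteq> S" using H(2) that by blast
    then show ?thesis
      using closed_cell_subset_closure closure_minimal[OF _ assms(2)] by blast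
  qed
  show ?thesis
  proof (rule simplicial_subdivision_of_cell_complex[of "closed_cell H ` S"])
    show "finite (closed_cell H ` S)"
      using finite_cells(2)[OF H(1)] by (rule rev_finite_subset) auto
    show "polytope C" if "C \<in> closed_cell H ` S" for C
      using that sub bounded_subset[OF assms(3)] H(1)
      by (auto simp: polytope_eq_bounded_polyhedron polyhedron_closed_cell)
    show "C1 \<inter> C2 face_of C1" if "C1 \<in> closed_cell H ` S" "C2 \<in> closed_cell H ` S" for C1 C2
      using that closed_cell_Int_face_of[OF H(1)] by auto
    fix \<T> assume \<T>: "simplicial_complex \<T>" "\<Union>\<T> = \<Union>(closed_cell H ` S)"
    have "\<Union>(closed_cell H ` S) = S" using sub by fastforce
    with \<T> that show thesis by auto
  qed
qed

text \<open>A minimal simplex containing \<open>x\<close> has \<open>x\<close> in its relative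
  interior, since otherwise a proper face would contain \<open>x\<close>. Two such simplices share a
  face that meets both relative interiors and so equals both.\<close>

lemma simplicial_complex_rel_interior_partition:
  assumes "simplicial_complex \<T>" "x \<in> \<Union>\<T>"
  shows "\<exists>!S. S \<in> \<T> - {{}} \<and> x \<in> rel_interior S"
proof (rule ex_ex1I)
  have fin: "finite \<T>" using assms(1) by (simp add: simplicial_complex_def)
  define X where "X = {S\<in>\<T>. x \<in> S}"
  have "finite X" "X \<noteq> {}" using fin assms(2) by (auto simp: X_def)
  then obtain S where S: "S \<in> X" "\<And>F. F \<in> X \<Longrightarrow> F \<subseteq> S \<Longrightarrow> F = S"
    using finite_has_minimal[of X] by metis
  have "polytope S" using S(1) assms(1) simplex_imp_polytope
    unfolding X_def simplicial_complex_def by blast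
  then have poly: "polyhedron S" "closed S" by (auto simp: polytope_imp_polyhedron polytope_imp_closed)
  have "x \<in> rel_interior S"
  proof (rule ccontr)
    assume "x \<notin> rel_interior S"
    then have "x \<in> rel_frontier S" using S(1) poly by (auto simp: X_def rel_frontier_def)
    then obtain F where F: "F face_of S" "F \<noteq> S" "x \<in> F"
      using rel_frontier_of_polyhedron_alt[OF poly(1)] by auto
    then have "F \<in> X" using S(1) assms(1) by (auto simp: X_def simplicial_complex_def)
    then show False using S(2) F face_of_imp_subset by blast
  qed
  then show "\<exists>S. S \<in> \<T> - {{}} \<and> x \<in> rel_interior S" using S(1) by (auto simp: X_def)
next
  have eq: "S \<inter> S' = S"
    if "S \<in> \<T>" "x \<in> rel_interior S" "S' \<in> \<T>" "x \<in> rel_interior S'" for S S'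
  proof -
    have "S \<inter> S' face_of S" using that assms(1) by (simp add: simplicial_complex_def)
    then show ?thesis
      using that face_of_disjoint_rel_interior[of "S \<inter> S'" S] rel_interior_subset by blast
  qed
  fix S S' assume "S \<in> \<T> - {{}} \<and> x \<in> rel_interior S" "S' \<in> \<T> - {{}} \<and> x \<in> rel_interior S'"
  then show "S = S'" using eq[of S S'] eq[of S' S] by blast
qed

lemma chi_rel_interior_polytope:
  assumes "polytope S" "S \<noteq> {}"
  shows "chi (indicator (rel_interior S)) = (-1) ^ nat (aff_dim S)"
proof -
  have S: "convex S" using assms by (simp add: polytope_imp_convex)
  have "chi (indicator (rel_interior S)) = (-1) ^ nat (aff_dim (rel_interior S))"
  proof (rule chi_rel_open_convex)
    show "bounded (rel_interior S)"
      by (rule bounded_subset[OF polytope_imp_bounded[OF assms(1)] rel_interior_subset])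
    show "indicator (rel_interior S) \<in> euler_functions"
      by (rule halfspace_ring_indicator[OF rel_interior_in_halfspace_ring[OF
            polytope_imp_polyhedron[OF assms(1)]]])
    show "convex (rel_interior S)" using S by (rule convex_rel_interior)
    show "rel_interior S \<noteq> {}" using rel_interior_eq_empty[OF S] assms(2) by simp
    show "rel_interior (rel_interior S) = rel_interior S"
      using S by (rule rel_interior_rel_interior)
  qed
  then show ?thesis unfolding rel_interior_aff_dim[OF S] .
qed

text \<open>The relative interiors of the nonempty simplices partition the union, and each
  contributes its term. The sum thus depends on the union alone, which is why the definite
  description in \<open>euler_char\<close> denotes.\<close>

lemma simplicial_complex_euler_sum:
  assumes "simplicial_complex \<T>"
  shows "(\<Sum>S\<in>\<T> - {{}}. (-1) ^ nat (aff_dim S)) = chi (indicator (\<Union>\<T>))"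
proof -
  have fin: "finite \<T>" and poly: "\<And>S. S \<in> \<T> \<Longrightarrow> polytope S"
    using assms simplex_imp_polytope unfolding simplicial_complex_def by blast+
  have "indicator (\<Union>\<T>) = (\<lambda>x. \<Sum>S\<in>\<T> - {{}}. indicator (rel_interior S) x :: int)"
  proof
    fix x
    show "indicator (\<Union>\<T>) x = (\<Sum>S\<in>\<T> - {{}}. indicator (rel_interior S) x :: int)"
    proof (cases "x \<in> \<Union>\<T>")
      case True
      then obtain S0 where S0: "S0 \<in> \<T> - {{}}" "x \<in> rel_interior S0"
        "\<And>S. S \<in> \<T> - {{}} \<Longrightarrow> x \<in> rel_interior S \<Longrightarrow> S = S0"
        using simplicial_complex_rel_interior_partition[OF assms True] by metis
      have "(\<Sum>S\<in>\<T> - {{}}. indicator (rel_interior S) x :: int) = (\<Sum>S\<in>\<T> - {{}}. if S = S0 then 1 else 0)"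
      proof (intro sum.cong refl)
        fix S assume "S \<in> \<T> - {{}}"
        then have "x \<in> rel_interior S \<longleftrightarrow> S = S0" using S0 by blast
        then show "indicator (rel_interior S) x = (if S = S0 then 1 else 0 :: int)"
          by (simp add: indicator_def)
      qed
      then show ?thesis using True S0(1) fin by simp
    next
      case False
      have "x \<notin> rel_interior S" if "S \<in> \<T>" for S
        using False that rel_interior_subset by blast
      then show ?thesis using False by simp
    qed
  qed
  then have "chi (indicator (\<Union>\<T>)) = (\<Sum>S\<in>\<T> - {{}}. chi (indicator (rel_interior S)))"
    using fin poly by (simp only:) (intro chi_sum halfspace_ring_indicator
      rel_interior_in_halfspace_ring polytope_imp_polyhedron; simp)
  also have "\<dots> = (\<Sum>S\<in>\<T> - {{}}. (-1) ^ nat (aff_dim S))"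
    using poly by (intro sum.cong) (auto simp: chi_rel_interior_polytope)
  finally show ?thesis by simp
qed

lemma euler_char_eq_chi:
  assumes "S \<in> halfspace_ring" "closed S" "bounded S"
  shows "euler_char S = chi (indicator S)"
  unfolding euler_char_def
proof (rule the_equality)
  show "\<exists>\<T>. simplicial_complex \<T> \<and> \<Union>\<T> = S \<and>
      chi (indicator S) = (\<Sum>S\<in>\<T> - {{}}. (-1) ^ nat (aff_dim S))"
    using halfspace_ring_triangulation[OF assms] simplicial_complex_euler_sum by metis
qed (auto simp: simplicial_complex_euler_sum)

section \<open>Agreement of the chosen Euler measure with \<open>chi\<close>\<close>

lemma chi_disjoint_Un:
  assumes "S \<in> halfspace_ring" "T \<in> halfspace_ring" "S \<inter> T = {}"
  shows "chi (indicator (S \<union> T)) = chi (indicator S) + chi (indicator T)"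
proof -
  have "indicator (S \<union> T) = (\<lambda>x. indicator S x + indicator T x :: int)"
    using assms(3) by (intro ext) (auto simp: indicator_def)
  then show ?thesis using assms by (simp add: chi_add halfspace_ring_indicator)
qed

text \<open>\<open>chi\<close> of indicators satisfies the defining condition, so the choice in
  \<open>euler_measure\<close> succeeds. This ties the chosen measure to \<open>chi\<close> on
  compact sets only.\<close>

lemma euler_measure:
  shows additive_euler_measure: "additive halfspace_ring (euler_measure :: 'a::euclidean_space set \<Rightarrow> int)"
    and euler_measure_compact: "\<And>S :: 'a set. S \<in> halfspace_ring \<Longrightarrow> closed S \<Longrightarrow> bounded S \<Longrightarrow>
      euler_measure S = chi (indicator S)"
proof -
  let ?P = "\<lambda>\<mu> :: 'a set \<Rightarrow> int. additive halfspace_ring \<mu> \<and>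
        (\<forall>X\<in>halfspace_ring. closed X \<and> bounded X \<longrightarrow> \<mu> X = euler_char X)"
  have "?P (\<lambda>S. chi (indicator S))"
    by (auto simp: additive_def chi_disjoint_Un euler_char_eq_chi)
  then have "?P euler_measure" unfolding euler_measure_def by (rule someI[of ?P])
  then show "additive halfspace_ring (euler_measure :: 'a set \<Rightarrow> int)"
    "\<And>S :: 'a set. S \<in> halfspace_ring \<Longrightarrow> closed S \<Longrightarrow> bounded S \<Longrightarrow> euler_measure S = chi (indicator S)"
    by (auto simp: euler_char_eq_chi)
qed

text \<open>The difference \<delta> of both measures is additive and vanishes on compact members of
  the ring. A bounded sign cell is a compact polyhedron minus a compact part, so \<delta> vanishes
  there too, and \<open>S\<close> is a finite disjoint union of such cells.\<close>

lemma euler_measure_bounded: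
  assumes S: "S \<in> halfspace_ring" "bounded S"
  shows "euler_measure S = chi (indicator S)"
proof -
  define \<delta> where "\<delta> X = euler_measure X - chi (indicator X)" for X :: "'a set"
  have \<delta>_Un: "\<delta> (X \<union> Y) = \<delta> X + \<delta> Y"
    if "X \<in> halfspace_ring" "Y \<in> halfspace_ring" "X \<inter> Y = {}" for X Y
  proof -
    have "euler_measure (X \<union> Y) = euler_measure X + euler_measure Y"
      using that additive_euler_measure[where 'a='a] unfolding additive_def by blast
    then show ?thesis using that by (simp add: \<delta>_def chi_disjoint_Un)
  qed
  have \<delta>_compact: "\<delta> X = 0" if "X \<in> halfspace_ring" "compact X" for X
    using that by (simp add: \<delta>_def euler_measure_compact compact_imp_closed compact_imp_bounded)
  obtain H where H: "finite H" "\<And>x y. y \<in> sign_cell H x \<Longrightarrow> y \<in> S \<longleftrightarrow> x \<in> S"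
    using halfspace_ring_sign_cells[OF S(1)] by blast
  have cell: "sign_cell H x \<in> halfspace_ring \<and> \<delta> (sign_cell H x) = 0" if "x \<in> S" for x
  proof -
    let ?Q = "closed_cell H x"
    \<comment> \<open>\<open>D\<close> collects the pairs whose affine function is nonzero at
      \<open>x\<close>; \<open>K\<close> is the part of the closed cell where one of these signs
      drops to 0.\<close>
    define D where "D = {(a, b)\<in>H. sgn (a \<bullet> x - b) \<noteq> 0}"
    define K where "K = (\<Union>(a, b)\<in>D. ?Q \<inter> {y. a \<bullet> y = b})"
    have poly: "polyhedron ?Q" by (rule polyhedron_closed_cell[OF H(1)])
    have "sign_cell H x \<subseteq> S" using H(2) that by blast
    then have "?Q \<subseteq> closure S"
      using closed_cell_subset_closure closure_mono by blast
    then have Q: "?Q \<in> halfspace_ring" "compact ?Q"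
      using poly S(2) bounded_subset[of "closure S" ?Q]
      by (auto simp: polyhedron_in_halfspace_ring polyhedron_imp_closed compact_eq_bounded_closed)
    have D: "finite D" using H(1) by (auto simp: D_def intro: rev_finite_subset)
    have "?Q \<inter> {y. a \<bullet> y = b} \<in> halfspace_ring" for a b
      by (intro polyhedron_in_halfspace_ring polyhedron_Int polyhedron_hyperplane poly)
    then have K_ring: "K \<in> halfspace_ring"
      unfolding K_def using D by (intro halfspace_ring.finite_UN) auto
    have "compact K"
      unfolding K_def using D Q by (intro compact_UN) (auto intro: compact_Int_closed closed_hyperplane)
    note K = K_ring this
    have eq: "sign_cell H x = ?Q - K"
    proof (intro equalityI subsetI)
      fix y assume y: "y \<in> sign_cell H x"
      have sgn_eq: "sgn (a \<bullet> y - b) = sgn (a \<bullet> x - b)" if "(a, b) \<in> H" for a b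
        using y that by (auto simp: sign_cell_def)
      have "y \<in> ?Q" unfolding closed_cell_def using sgn_eq by auto
      moreover have "a \<bullet> y \<noteq> b" if "(a, b) \<in> D" for a b
        using that sgn_eq[of a b] by (auto simp: D_def)
      then have "y \<notin> K" unfolding K_def by auto
      ultimately show "y \<in> ?Q - K" by blast
    next
      fix y assume y: "y \<in> ?Q - K"
      have "sgn (a \<bullet> y - b) = sgn (a \<bullet> x - b)" if ab: "(a, b) \<in> H" for a b
      proof (rule ccontr)
        assume ne: "sgn (a \<bullet> y - b) \<noteq> sgn (a \<bullet> x - b)"
        then have "sgn (a \<bullet> y - b) = 0"
          using y ab unfolding closed_cell_def by auto
        with ne ab y have "(a, b) \<in> D" "y \<in> ?Q \<inter> {y. a \<bullet> y = b}"
          by (auto simp: D_def sgn_eq_0_iff)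
        then have "y \<in> K" unfolding K_def by auto
        then show False using y by simp
      qed
      then show "y \<in> sign_cell H x" by (auto simp: sign_cell_def)
    qed
    have "K \<subseteq> ?Q" by (auto simp: K_def)
    then have "?Q - K \<union> K = ?Q" by blast
    moreover have "\<delta> (?Q - K \<union> K) = \<delta> (?Q - K) + \<delta> K"
      using Q(1) K(1) by (intro \<delta>_Un halfspace_ring.Diff) auto
    ultimately have "\<delta> ?Q = \<delta> (?Q - K) + \<delta> K" by simp
    then have "\<delta> (?Q - K) = 0" using \<delta>_compact[OF Q] \<delta>_compact[OF K] by simp
    then show ?thesis unfolding eq using halfspace_ring.Diff[OF Q(1) K(1)] by simp
  qed
  have fin: "finite (sign_cell H ` S)"
    using finite_cells(1)[OF H(1)] by (rule rev_finite_subset) auto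
  have disj: "X \<inter> Y = {}" if "X \<in> sign_cell H ` S" "Y \<in> sign_cell H ` S" "X \<noteq> Y" for X Y
    using that unfolding sign_cell_def by fastforce
  have "\<Union>\<D> \<in> halfspace_ring \<and> \<delta> (\<Union>\<D>) = 0" if "finite \<D>" "\<D> \<subseteq> sign_cell H ` S" for \<D>
    using that
  proof (induction \<D>)
    case empty
    then show ?case using \<delta>_compact[of "{}"] by simp
  next
    case (insert X \<D>)
    have "X \<inter> Y = {}" if "Y \<in> \<D>" for Y using that insert by (intro disj) auto
    then have "\<delta> (X \<union> \<Union>\<D>) = \<delta> X + \<delta> (\<Union>\<D>)"
      using insert cell by (intro \<delta>_Un) auto
    then show ?case using insert cell by auto
  qed
  from this[OF fin subset_refl] have "\<delta> (\<Union>(sign_cell H ` S)) = 0" by simp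
  moreover have "\<Union>(sign_cell H ` S) = S"
  proof (intro equalityI subsetI)
    show "y \<in> S" if "y \<in> \<Union>(sign_cell H ` S)" for y
      using that H(2) by blast
  qed (blast intro: mem_sign_cell)
  ultimately show ?thesis by (simp only: \<delta>_def)
qed

section \<open>Integration and convolution\<close>

lemma Zc_iff: "f \<in> Zc \<longleftrightarrow>
    finite (range f) \<and> (\<forall>n. f -` {n} \<in> halfspace_ring) \<and> bounded {x. f x \<noteq> 0}"
  by (simp add: Zc_def compact_closure)

text \<open>A level set of the result is a finite union of intersections of level sets of
  \<open>f\<close> and \<open>g\<close>. The condition \<open>h 0 0 = 0\<close> keeps the support
  bounded.\<close>

lemma Zc_combine:
  assumes f: "f \<in> Zc" and g: "g \<in> Zc" and h: "h 0 0 = 0"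
  shows "(\<lambda>x. h (f x) (g x)) \<in> Zc"
  unfolding Zc_iff
proof (intro conjI allI)
  have "range (\<lambda>x. h (f x) (g x)) \<subseteq> (\<lambda>(a, b). h a b) ` (range f \<times> range g)"
    by auto
  then show "finite (range (\<lambda>x. h (f x) (g x)))"
    by (rule finite_subset) (use f g in \<open>simp add: Zc_iff\<close>)
  fix n
  define P where "P = {(a, b) \<in> range f \<times> range g. h a b = n}"
  have "finite (range f \<times> range g)" using f g by (simp add: Zc_iff)
  then have "finite P" by (rule rev_finite_subset) (auto simp: P_def)
  then have "(\<Union>p\<in>P. f -` {fst p} \<inter> g -` {snd p}) \<in> halfspace_ring"
    using f g by (intro halfspace_ring.finite_UN) (auto simp: Zc_iff intro!: halfspace_ring.Int)
  also have "(\<Union>p\<in>P. f -` {fst p} \<inter> g -` {snd p}) = (\<lambda>x. h (f x) (g x)) -` {n}"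
  proof (intro equalityI subsetI)
    fix x assume "x \<in> (\<lambda>x. h (f x) (g x)) -` {n}"
    then have "(f x, g x) \<in> P" by (simp add: P_def)
    then show "x \<in> (\<Union>p\<in>P. f -` {fst p} \<inter> g -` {snd p})"
      by (rule UN_I) simp
  qed (auto simp: P_def)
  finally show "(\<lambda>x. h (f x) (g x)) -` {n} \<in> halfspace_ring" .
next
  have "bounded ({x. f x \<noteq> 0} \<union> {x. g x \<noteq> 0})"
    using f g by (simp add: Zc_iff)
  then show "bounded {x. h (f x) (g x) \<noteq> 0}"
  proof (rule bounded_subset)
    show "{x. h (f x) (g x) \<noteq> 0} \<subseteq> {x. f x \<noteq> 0} \<union> {x. g x \<noteq> 0}"
      using h by auto
  qed
qed

lemma Zc_indicator:
  assumes "S \<in> halfspace_ring" "bounded S"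
  shows "indicator S \<in> Zc"
  unfolding Zc_iff
proof (intro conjI allI)
  have "range (indicator S :: 'a \<Rightarrow> int) \<subseteq> {0, 1}" by (auto simp: indicator_def)
  then show "finite (range (indicator S :: 'a \<Rightarrow> int))" by (rule finite_subset) simp
  have "(indicator S :: 'a \<Rightarrow> int) -` {n} = (if n = 0 then UNIV - S else if n = 1 then S else {})" for n
    by (auto simp: indicator_def split: if_splits)
  then show "(indicator S :: 'a \<Rightarrow> int) -` {n} \<in> halfspace_ring" for n
    using assms(1) by (simp add: halfspace_ring.Diff)
  show "bounded {x. indicator S x \<noteq> (0::int)}" using assms(2) by (simp add: indicator_def)
qed

lemma Zc_indicator_polytope: "polytope S \<Longrightarrow> indicator S \<in> Zc"
  by (intro Zc_indicator polyhedron_in_halfspace_ring polytope_imp_polyhedron polytope_imp_bounded)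

lemma reflect_in_halfspace_ring:
  assumes "S \<in> halfspace_ring"
  shows "(\<lambda>y. x - y) -` S \<in> halfspace_ring"
proof -
  let ?M = "{S. (\<lambda>y. x - y) -` S \<in> halfspace_ring}"
  have "S \<in> ?M"
  proof (rule halfspace_ring_minimal[OF assms])
    show "ring_of_sets UNIV ?M"
      by (rule ring_of_setsI) (auto simp: vimage_Un vimage_Diff)
    show "{y. a \<bullet> y \<le> b} \<in> ?M" if "a \<noteq> 0" for a b
    proof -
      have "(\<lambda>y. x - y) -` {y. a \<bullet> y \<le> b} = {y. (-a) \<bullet> y \<le> b - a \<bullet> x}"
        by (auto simp: inner_diff_right)
      then show ?thesis using halfspace_in_halfspace_ring[of "-a"] that by simp
    qed
  qed
  then show ?thesis by simp
qed

lemma bounded_reflect: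
  fixes S :: "'a::real_normed_vector set"
  assumes "bounded S"
  shows "bounded ((\<lambda>y. x - y) -` S)"
proof -
  have "(\<lambda>y. x - y) -` S \<subseteq> (\<lambda>y. x + y) ` uminus ` S"
  proof
    fix y assume "y \<in> (\<lambda>y. x - y) -` S"
    then have "x + - (x - y) \<in> (\<lambda>y. x + y) ` uminus ` S" by blast
    then show "y \<in> (\<lambda>y. x + y) ` uminus ` S" by simp
  qed
  moreover have "bounded ((\<lambda>y. x + y) ` uminus ` S)"
    using assms by (intro bounded_translation) (simp add: bounded_uminus)
  ultimately show ?thesis using bounded_subset by blast
qed

lemma Zc_reflect:
  assumes "f \<in> Zc"
  shows "(\<lambda>y. f (x - y)) \<in> Zc"
  unfolding Zc_iff
proof (intro conjI allI)
  have "range (\<lambda>y. f (x - y)) \<subseteq> range f" by auto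
  then show "finite (range (\<lambda>y. f (x - y)))"
    by (rule finite_subset) (use assms in \<open>simp add: Zc_iff\<close>)
  show "(\<lambda>y. f (x - y)) -` {n} \<in> halfspace_ring" for n
    using reflect_in_halfspace_ring[of "f -` {n}" x] assms by (simp add: Zc_iff vimage_def)
  show "bounded {y. f (x - y) \<noteq> 0}"
    using bounded_reflect[of "{y. f y \<noteq> 0}" x] assms by (simp add: Zc_iff vimage_def)
qed

text \<open>This class contains \<open>Zc\<close> and consists of combinations of compact convex
  sets that may be other than polytopes, which supports induction over indicators.\<close>

definition compact_euler_functions :: "('a::euclidean_space \<Rightarrow> int) set" where
  "compact_euler_functions = {f \<in> euler_functions. bounded {x. f x \<noteq> 0}}"

lemma compact_euler_functionsD: "f \<in> compact_euler_functions \<Longrightarrow> f \<in> euler_functions"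
  by (simp add: compact_euler_functions_def)

lemma
  assumes "f \<in> Zc"
  shows Zc_compact_euler: "f \<in> compact_euler_functions"
    and euler_integral_eq_chi: "euler_integral f = chi f"
proof -
  have fin: "finite (range f)" and ring: "f -` {n} \<in> halfspace_ring" for n
    using assms by (auto simp: Zc_iff)
  have f: "f = (\<lambda>x. \<Sum>n\<in>range f. n * indicator (f -` {n}) x)"
  proof
    fix x
    have "(\<Sum>n\<in>range f. n * indicator (f -` {n}) x) = (\<Sum>n\<in>range f. if n = f x then n else 0)"
      by (intro sum.cong) (auto simp: indicator_def)
    then show "f x = (\<Sum>n\<in>range f. n * indicator (f -` {n}) x)" using fin by simp
  qed
  have ind: "(\<lambda>x. n * indicator (f -` {n}) x) \<in> euler_functions" for n
    by (intro euler_functions_scale halfspace_ring_indicator ring)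
  have "(\<lambda>x. \<Sum>n\<in>range f. n * indicator (f -` {n}) x) \<in> euler_functions"
    by (rule euler_functions_sum[OF fin ind])
  then have "f \<in> euler_functions" using f by metis
  then show "f \<in> compact_euler_functions"
    using assms by (simp add: compact_euler_functions_def Zc_iff)
  have "chi (\<lambda>x. \<Sum>n\<in>range f. n * indicator (f -` {n}) x)
      = (\<Sum>n\<in>range f. n * chi (indicator (f -` {n})))"
    by (subst chi_sum[OF fin ind]) (simp add: chi_scale halfspace_ring_indicator ring)
  also have "\<dots> = (\<Sum>n\<in>range f. n * euler_measure (f -` {n}))"
  proof (intro sum.cong refl)
    fix n
    \<comment> \<open>The level set of 0 is unbounded but enters with coefficient 0. All others lie
      in the bounded support, so both measures agree on them.\<close>
    have "bounded {x. f x \<noteq> 0}" using assms by (simp add: Zc_iff)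
    then have "bounded (f -` {n})" if "n \<noteq> 0"
      by (rule bounded_subset) (use that in auto)
    then show "n * chi (indicator (f -` {n})) = n * euler_measure (f -` {n})"
      using euler_measure_bounded[OF ring] by (cases "n = 0") auto
  qed
  finally show "euler_integral f = chi f"
    unfolding euler_integral_def using f by metis
qed

text \<open>Adding one indicator at a time reduces identities that are linear in \<open>f\<close> to
  indicators of compact convex sets.\<close>

lemma compact_euler_induct [consumes 1, case_names zero add]:
  assumes "f \<in> compact_euler_functions"
    and zero: "P (\<lambda>x. 0)"
    and add: "\<And>n S f. compact S \<Longrightarrow> convex S \<Longrightarrow> S \<noteq> {} \<Longrightarrow> f \<in> compact_euler_functions \<Longrightarrow> P f \<Longrightarrow>
      P (\<lambda>x. n * indicator S x + f x)"
  shows "P f"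
proof -
  obtain ps where ps: "convex_comb ps" "\<forall>S\<in>snd ` set ps. compact S" "f = lincomb ps"
    using assms(1) euler_functions_compactE unfolding compact_euler_functions_def by blast
  have "lincomb ps \<in> compact_euler_functions \<and> P (lincomb ps)"
    if "convex_comb ps" "\<forall>S\<in>snd ` set ps. compact S" for ps
    using that
  proof (induction ps)
    case Nil
    have "lincomb [] = (\<lambda>x::'a. 0)" by auto
    then show ?case using zero by (simp add: compact_euler_functions_def)
  next
    case (Cons p ps)
    obtain n S where p: "p = (n, S)" by force
    have IH: "lincomb ps \<in> compact_euler_functions" "P (lincomb ps)" using Cons p by auto
    have S: "compact S" "convex S" "S \<noteq> {}" using Cons p by auto
    have eq: "lincomb (p # ps) = (\<lambda>x. n * indicator S x + lincomb ps x)"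
      by (auto simp: p)
    have "bounded (S \<union> {x. lincomb ps x \<noteq> 0})"
      using IH(1) S by (simp add: compact_euler_functions_def compact_imp_bounded)
    then have "bounded {x. lincomb (p # ps) x \<noteq> 0}"
      by (rule bounded_subset) (auto simp: p indicator_def)
    then have "lincomb (p # ps) \<in> compact_euler_functions"
      using euler_functionsI[OF Cons.prems(1) refl] by (simp only: compact_euler_functions_def mem_Collect_eq simp_thms)
    moreover have "P (lincomb (p # ps))" unfolding eq by (rule add[OF S IH])
    ultimately show ?case by blast
  qed
  with ps show ?thesis by blast
qed

lemma compact_euler_zero [simp]: "(\<lambda>x. 0) \<in> compact_euler_functions"
  by (simp add: compact_euler_functions_def)

lemma compact_euler_indicator:
  assumes "compact S" "convex S"
  shows "indicator S \<in> compact_euler_functions"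
proof -
  have "{x. indicator S x \<noteq> (0 :: int)} = S" by (auto simp: indicator_def)
  then show ?thesis
    using assms euler_functions_indicator[of S]
    by (simp add: compact_euler_functions_def compact_imp_closed compact_imp_bounded)
qed

lemma compact_euler_add:
  assumes "f \<in> compact_euler_functions" "g \<in> compact_euler_functions"
  shows "(\<lambda>x. n * f x + g x) \<in> compact_euler_functions"
proof -
  have "bounded ({x. f x \<noteq> 0} \<union> {x. g x \<noteq> 0})"
    using assms by (simp add: compact_euler_functions_def)
  then have "bounded {x. n * f x + g x \<noteq> 0}"
    by (rule bounded_subset) auto
  moreover have "(\<lambda>x. n * f x + g x) \<in> euler_functions"
    by (intro euler_functions_add euler_functions_scale compact_euler_functionsD assms)
  ultimately show ?thesis by (simp add: compact_euler_functions_def)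
qed

lemma indicator_reflect:
  fixes x y :: "'a::ab_group_add"
  shows "indicator S (x - y) = (indicator ((\<lambda>y. x - y) ` S) y :: 'b::zero_neq_one)"
proof -
  have "y = x - s \<longleftrightarrow> s = x - y" for s by (auto simp: algebra_simps)
  then have "y \<in> (\<lambda>y. x - y) ` S \<longleftrightarrow> x - y \<in> S" unfolding image_iff by simp
  then show ?thesis by (simp only: indicator_def)
qed

lemma compact_convex_reflect:
  fixes S :: "'a::euclidean_space set"
  assumes "compact S" "convex S"
  shows "compact ((\<lambda>y. x - y) ` S)" "convex ((\<lambda>y. x - y) ` S)"
proof -
  show "compact ((\<lambda>y. x - y) ` S)"
    by (intro compact_continuous_image continuous_intros assms)
  have "(\<lambda>y. x - y) ` S = (\<lambda>y. x + y) ` uminus ` S" by (simp add: image_image)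
  then show "convex ((\<lambda>y. x - y) ` S)"
    using assms by (simp only: convex_translation convex_negations)
qed

lemma compact_euler_reflect:
  assumes "f \<in> compact_euler_functions"
  shows "(\<lambda>y. f (x - y)) \<in> compact_euler_functions"
  using assms
proof (induction rule: compact_euler_induct)
  case (add n S f)
  then show ?case
    by (simp add: indicator_reflect compact_euler_add compact_euler_indicator compact_convex_reflect)
qed simp

section \<open>Convolution and its algebraic laws\<close>

definition conv :: "('a::euclidean_space \<Rightarrow> int) \<Rightarrow> ('a \<Rightarrow> int) \<Rightarrow> 'a \<Rightarrow> int" where
  "conv f g x = chi (\<lambda>y. f y * g (x - y))"

text \<open>On \<open>Zc\<close> the Euler integral is \<open>chi\<close>, and the integrand stays
  in \<open>Zc\<close>. The laws of the product can therefore be proved for \<open>conv\<close>, on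
  all compact Euler functions.\<close>

lemma mink_prod_eq_conv:
  assumes "f \<in> Zc" "g \<in> Zc"
  shows "f \<star> g = conv f g"
  unfolding mink_prod_def conv_def
  by (intro ext euler_integral_eq_chi Zc_combine[of f _ "(*)"] Zc_reflect assms) simp

lemma conv_integrand:
  assumes "f \<in> compact_euler_functions" "g \<in> compact_euler_functions"
  shows "(\<lambda>y. f y * g (x - y)) \<in> euler_functions"
  using assms by (intro euler_functions_mult compact_euler_functionsD compact_euler_reflect)

lemma conv_lincomb_left:
  assumes "f \<in> compact_euler_functions" "f' \<in> compact_euler_functions" "g \<in> compact_euler_functions"
  shows "conv (\<lambda>x. n * f x + f' x) g = (\<lambda>x. n * conv f g x + conv f' g x)"
proof
  fix x
  have "(\<lambda>y. (n * f y + f' y) * g (x - y)) = (\<lambda>y. n * (f y * g (x - y)) + f' y * g (x - y))"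
    by (auto simp: algebra_simps)
  then show "conv (\<lambda>x. n * f x + f' x) g x = n * conv f g x + conv f' g x"
    using assms by (simp add: conv_def chi_add chi_scale euler_functions_scale conv_integrand)
qed

lemma conv_lincomb_right:
  assumes "f \<in> compact_euler_functions" "g \<in> compact_euler_functions" "g' \<in> compact_euler_functions"
  shows "conv f (\<lambda>x. n * g x + g' x) = (\<lambda>x. n * conv f g x + conv f g' x)"
proof
  fix x
  have "(\<lambda>y. f y * (n * g (x - y) + g' (x - y))) = (\<lambda>y. n * (f y * g (x - y)) + f y * g' (x - y))"
    by (auto simp: algebra_simps)
  then show "conv f (\<lambda>x. n * g x + g' x) x = n * conv f g x + conv f g' x"
    using assms by (simp add: conv_def chi_add chi_scale euler_functions_scale conv_integrand)
qed

lemma conv_zero [simp]: "conv (\<lambda>x. 0) g = (\<lambda>x. 0)" "conv f (\<lambda>x. 0) = (\<lambda>x. 0)"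
  by (auto simp: conv_def)

text \<open>The integrand is the indicator of the part of \<open>S\<close> lying in the reflected
  set of all \<open>x - t\<close> with \<open>t\<close> in \<open>T\<close>. This part is closed and
  convex, and it is nonempty exactly for \<open>x\<close> in \<open>S + T\<close>, where
  \<open>chi\<close> gives 1.\<close>

lemma conv_indicator:
  assumes S: "compact S" "convex S" and T: "compact T" "convex T"
  shows "conv (indicator S) (indicator T) = indicator (S + T)"
proof
  fix x
  let ?D = "S \<inter> (\<lambda>y. x - y) ` T"
  have "(\<lambda>y. indicator S y * indicator T (x - y)) = (indicator ?D :: 'a \<Rightarrow> int)"
    by (auto simp: indicator_reflect indicator_inter_arith)
  then have "conv (indicator S) (indicator T) x = chi (indicator ?D)"
    by (simp add: conv_def)
  moreover have D: "closed ?D" "convex ?D"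
    using compact_convex_reflect[OF T, of x] S by (auto intro: convex_Int simp: compact_imp_closed)
  have "x \<in> S + T \<longleftrightarrow> ?D \<noteq> {}"
  proof
    assume "x \<in> S + T"
    then obtain s t where "s \<in> S" "t \<in> T" "x = s + t" by (auto elim: set_plus_elim)
    then have "s \<in> ?D" by (auto intro!: image_eqI[of _ _ t])
    then show "?D \<noteq> {}" by blast
  next
    assume "?D \<noteq> {}"
    then obtain t where t: "t \<in> T" "x - t \<in> S" by auto
    then have "(x - t) + t \<in> S + T" by (intro set_plus_intro)
    then show "x \<in> S + T" by simp
  qed
  moreover have "chi (indicator ?D) = (if ?D = {} then 0 else 1)"
  proof (cases "?D = {}")
    case True
    have "indicator {} = (\<lambda>x::'a. 0 :: int)" by auto
    then show ?thesis unfolding True by simp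
  next
    case False
    then show ?thesis using chi_indicator[OF D False] by (simp only: if_False)
  qed
  ultimately show "conv (indicator S) (indicator T) x = indicator (S + T) x"
    by (simp add: indicator_def)
qed

lemma compact_convex_set_plus:
  fixes S T :: "'a::euclidean_space set"
  assumes "compact S" "convex S" "compact T" "convex T"
  shows "compact (S + T)" "convex (S + T)"
proof -
  have "S + T = {x + y |x y. x \<in> S \<and> y \<in> T}" by (auto simp: set_plus_def)
  then show "compact (S + T)" using compact_sums[OF assms(1,3)] by simp
  show "convex (S + T)" by (intro convex_set_plus assms)
qed

text \<open>By bilinearity two indicators suffice, and their convolution is the indicator of a
  compact convex sum. The same double induction gives commutativity below.\<close>

lemma compact_euler_conv:
  assumes f: "f \<in> compact_euler_functions" and g: "g \<in> compact_euler_functions"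
  shows "conv f g \<in> compact_euler_functions"
  using f
proof (induction rule: compact_euler_induct)
  case zero
  show ?case by simp
next
  case (add n S f)
  note S = add(1,2) compact_euler_indicator[OF add(1,2)]
  have "conv (indicator S) g \<in> compact_euler_functions"
    using g
  proof (induction rule: compact_euler_induct)
    case zero
    show ?case by simp
  next
    case (add m T g)
    note T = add(1,2) compact_euler_indicator[OF add(1,2)]
    have "(indicator (S + T) :: 'a \<Rightarrow> int) \<in> compact_euler_functions"
      by (intro compact_euler_indicator compact_convex_set_plus S T)
    then show ?case
      unfolding conv_lincomb_right[OF S(3) T(3) add(4)] conv_indicator[OF S(1,2) T(1,2)]
      by (rule compact_euler_add[OF _ add(5)])
  qed
  then show ?case
    unfolding conv_lincomb_left[OF S(3) add(4) g] by (rule compact_euler_add[OF _ add(5)])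
qed

lemma conv_commute:
  assumes f: "f \<in> compact_euler_functions" and g: "g \<in> compact_euler_functions"
  shows "conv f g = conv g f"
  using f
proof (induction rule: compact_euler_induct)
  case zero
  show ?case by simp
next
  case (add n S f)
  note S = add(1,2) compact_euler_indicator[OF add(1,2)]
  have "conv (indicator S) g = conv g (indicator S)"
    using g
  proof (induction rule: compact_euler_induct)
    case zero
    show ?case by simp
  next
    case (add m T g)
    note T = add(1,2) compact_euler_indicator[OF add(1,2)]
    show ?case
      unfolding conv_lincomb_right[OF S(3) T(3) add(4)] conv_lincomb_left[OF T(3) add(4) S(3)]
        conv_indicator[OF S(1,2) T(1,2)] conv_indicator[OF T(1,2) S(1,2)]
        add.commute[of S T] add(5) ..
  qed
  then show ?case
    unfolding conv_lincomb_left[OF S(3) add(4) g] conv_lincomb_right[OF g S(3) add(4)] add(5)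
    by simp
qed

text \<open>Linearity in each argument reduces the claim to three indicators, for which it is
  associativity of Minkowski addition.\<close>

lemma conv_assoc:
  assumes f: "f \<in> compact_euler_functions" and g: "g \<in> compact_euler_functions"
    and h: "h \<in> compact_euler_functions"
  shows "conv (conv f g) h = conv f (conv g h)"
  using f
proof (induction rule: compact_euler_induct)
  case zero
  show ?case by simp
next
  case (add n S f)
  note S = add(1,2) compact_euler_indicator[OF add(1,2)]
  have "conv (conv (indicator S) g) h = conv (indicator S) (conv g h)"
    using g
  proof (induction rule: compact_euler_induct)
    case zero
    show ?case by simp
  next
    case (add m T g)
    note T = add(1,2) compact_euler_indicator[OF add(1,2)]
    have "conv (conv (indicator S) (indicator T)) h = conv (indicator S) (conv (indicator T) h)"
      using h
    proof (induction rule: compact_euler_induct)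
      case zero
      show ?case by simp
    next
      case (add k U h)
      note U = add(1,2) compact_euler_indicator[OF add(1,2)]
      note ST = compact_convex_set_plus[OF S(1,2) T(1,2)]
      note TU = compact_convex_set_plus[OF T(1,2) U(1,2)]
      have "conv (conv (indicator S) (indicator T)) (indicator U)
          = conv (indicator S) (conv (indicator T) (indicator U))"
        unfolding conv_indicator[OF S(1,2) T(1,2)] conv_indicator[OF T(1,2) U(1,2)]
          conv_indicator[OF ST U(1,2)] conv_indicator[OF S(1,2) TU] add.assoc ..
      then show ?case
        unfolding conv_lincomb_right[OF compact_euler_conv[OF S(3) T(3)] U(3) add(4)]
          conv_lincomb_right[OF T(3) U(3) add(4)]
          conv_lincomb_right[OF S(3) compact_euler_conv[OF T(3) U(3)] compact_euler_conv[OF T(3) add(4)]]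
          add(5) by simp
    qed
    then show ?case
      unfolding conv_lincomb_right[OF S(3) T(3) add(4)] conv_lincomb_left[OF T(3) add(4) h]
        conv_lincomb_left[OF compact_euler_conv[OF S(3) T(3)] compact_euler_conv[OF S(3) add(4)] h]
        conv_lincomb_right[OF S(3) compact_euler_conv[OF T(3) h] compact_euler_conv[OF add(4) h]]
        add(5) by simp
  qed
  then show ?case
    unfolding conv_lincomb_left[OF S(3) add(4) g]
      conv_lincomb_left[OF compact_euler_conv[OF S(3) g] compact_euler_conv[OF add(4) g] h]
      conv_lincomb_left[OF S(3) add(4) compact_euler_conv[OF g h]]
      add(5) by simp
qed

lemma conv_indicator_0:
  assumes "f \<in> compact_euler_functions"
  shows "conv f (indicator {0}) = f"
  using assms
proof (induction rule: compact_euler_induct)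
  case zero
  show ?case by simp
next
  case (add n S f)
  note S = add(1,2) compact_euler_indicator[OF add(1,2)]
  have "S + {0} = S" by (auto simp: set_plus_def)
  then have "conv (indicator S) (indicator {0}) = indicator S"
    using conv_indicator[OF S(1,2), of "{0}"] by simp
  moreover have "indicator {0} \<in> compact_euler_functions"
    by (rule compact_euler_indicator) auto
  ultimately show ?case
    unfolding conv_lincomb_left[OF S(3) add(4) \<open>indicator {0} \<in> compact_euler_functions\<close>] add(5)
    by simp
qed

section \<open>Inverting polytopes\<close>

lemma bounded_line_section:
  fixes S :: "'a::real_normed_vector set"
  assumes "bounded S" "b \<noteq> 0"
  shows "bounded {t. y + t *\<^sub>R b \<in> S}"
proof -
  obtain M where M: "\<And>x. x \<in> S \<Longrightarrow> norm x \<le> M"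
    using assms(1) unfolding bounded_iff by blast
  have "norm t \<le> (M + norm y) / norm b" if t: "t \<in> {t. y + t *\<^sub>R b \<in> S}" for t
  proof -
    have "norm (t *\<^sub>R b) \<le> norm (y + t *\<^sub>R b) + norm y"
      using norm_triangle_ineq4[of "y + t *\<^sub>R b" y] by simp
    also have "\<dots> \<le> M + norm y" using M t by simp
    finally show ?thesis using assms(2) by (simp add: pos_le_divide_eq)
  qed
  then show ?thesis unfolding bounded_iff by blast
qed

text \<open>A segment from a relative interior point to a point of \<open>P\<close> stays in the
  relative interior, except possibly at its far end; this covers everything strictly between
  \<open>p\<close> and \<open>q\<close>. The endpoints are excluded because segments can be
  prolonged beyond relative interior points.\<close>

lemma rel_interior_line_section:
  fixes P :: "'a::euclidean_space set"
  assumes P: "compact P" "convex P" and b: "b \<noteq> 0"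
    and ne: "{t. y + t *\<^sub>R b \<in> rel_interior P} \<noteq> {}"
  obtains p q where "{t. y + t *\<^sub>R b \<in> P} = {p..q}" "p \<le> q"
    "p < q \<Longrightarrow> {t. y + t *\<^sub>R b \<in> rel_interior P} = {p<..<q}"
proof -
  let ?I = "{t. y + t *\<^sub>R b \<in> P}" and ?O = "{t. y + t *\<^sub>R b \<in> rel_interior P}"
  have OI: "?O \<subseteq> ?I" using rel_interior_subset by blast
  have "closed ?I"
    using continuous_closed_vimage[OF compact_imp_closed[OF P(1)], of "\<lambda>t. y + t *\<^sub>R b"]
    by (simp add: vimage_def)
  then have "compact ?I"
    using bounded_line_section[OF compact_imp_bounded[OF P(1)] b]
    by (simp add: compact_eq_bounded_closed)
  moreover have "convex ?I" by (rule convex_line_section[OF P(2)])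
  ultimately obtain p q where I: "?I = {p..q}"
    using connected_compact_interval_1[of ?I] convex_connected[of ?I] by auto
  have pq: "p \<le> q" using ne OI I by auto
  \<comment> \<open>For \<open>p = q\<close> the section of the relative interior is the single
    point \<open>p\<close> and not the empty open interval; hence the restriction to
    \<open>p < q\<close>.\<close>
  have "?O = {p<..<q}" if "p < q"
  proof -
    have in_P: "y + t *\<^sub>R b \<in> P \<longleftrightarrow> p \<le> t \<and> t \<le> q" for t
      using I by (metis (no_types, lifting) atLeastAtMost_iff mem_Collect_eq)
    obtain s where s: "y + s *\<^sub>R b \<in> rel_interior P" using ne by blast
    have seg: "y + t *\<^sub>R b \<in> rel_interior P"
      if r: "p \<le> r" "r \<le> q" and t: "s < t \<and> t < r \<or> r < t \<and> t < s" for r t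
    proof -
      have "y + r *\<^sub>R b \<in> closure P" using in_P r closure_subset by blast
      then have "open_segment (y + s *\<^sub>R b) (y + r *\<^sub>R b) \<subseteq> rel_interior P"
        by (rule rel_interior_closure_convex_segment[OF P(2) s])
      moreover have "y + t *\<^sub>R b \<in> open_segment (y + s *\<^sub>R b) (y + r *\<^sub>R b)"
      proof -
        define u where "u = (t - s) / (r - s)"
        have u: "0 < u" "u < 1" using t by (auto simp: u_def divide_simps)
        have "u * (r - s) = t - s" using t by (auto simp: u_def)
        then have eq: "t = (1 - u) * s + u * r" by (simp add: algebra_simps)
        have "y + t *\<^sub>R b = (1 - u) *\<^sub>R (y + s *\<^sub>R b) + u *\<^sub>R (y + r *\<^sub>R b)"
          unfolding eq by (simp add: algebra_simps)
        moreover have "y + s *\<^sub>R b \<noteq> y + r *\<^sub>R b" using t b by auto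
        ultimately show ?thesis using u unfolding in_segment by blast
      qed
      ultimately show ?thesis by blast
    qed
    \<comment> \<open>A segment in \<open>P\<close> that ends at a relative interior point
      \<open>z\<close> can be prolonged beyond \<open>z\<close> within \<open>P\<close>; the
      assumption \<open>out\<close> excludes this.\<close>
    have end_pt: False
      if z: "y + z *\<^sub>R b \<in> rel_interior P" and w: "p \<le> w" "w \<le> q" "w \<noteq> z"
        and out: "\<And>e. e > 1 \<Longrightarrow> \<not> (p \<le> w + e * (z - w) \<and> w + e * (z - w) \<le> q)" for z w
    proof -
      have "y + w *\<^sub>R b \<in> P" using in_P w by simp
      then obtain e where e: "e > 1" "(1 - e) *\<^sub>R (y + w *\<^sub>R b) + e *\<^sub>R (y + z *\<^sub>R b) \<in> P"
        using z P(2) ne convex_rel_interior_iff[of P "y + z *\<^sub>R b"] by fastforce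
      have "(1 - e) *\<^sub>R (y + w *\<^sub>R b) + e *\<^sub>R (y + z *\<^sub>R b) = y + (w + e * (z - w)) *\<^sub>R b"
        by (simp add: algebra_simps)
      with e have "p \<le> w + e * (z - w) \<and> w + e * (z - w) \<le> q" using in_P by simp
      then show False using out e(1) by blast
    qed
    have "p \<notin> ?O"
    proof
      assume "p \<in> ?O"
      moreover have "q + e * (p - q) < p" if "e > 1" for e
        using mult_strict_right_mono[OF that, of "q - p"] \<open>p < q\<close> by (simp add: algebra_simps)
      ultimately show False using end_pt[of p q] \<open>p < q\<close> by fastforce
    qed
    moreover have "q \<notin> ?O"
    proof
      assume "q \<in> ?O"
      moreover have "q < p + e * (q - p)" if "e > 1" for e
        using mult_strict_right_mono[OF that, of "q - p"] \<open>p < q\<close> by (simp add: algebra_simps)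
      ultimately show False using end_pt[of q p] \<open>p < q\<close> by fastforce
    qed
    moreover have "t \<in> ?O" if "p < t" "t < q" for t
      using that seg[of p t] seg[of q t] s by (cases s t rule: linorder_cases) auto
    moreover have "p \<le> t \<and> t \<le> q" if "t \<in> ?O" for t
      using that OI in_P by blast
    ultimately show ?thesis
      by (intro equalityI subsetI) (force simp: less_le)+
  qed
  with I pq show ?thesis by (rule that)
qed

definition polytope_inverse :: "'a::euclidean_space set \<Rightarrow> 'a \<Rightarrow> int" where
  "polytope_inverse P = (\<lambda>x. (-1) ^ nat (aff_dim P) * indicator (rel_interior P) (- x))"

lemma polytope_inverse_Zc:
  assumes "polytope P"
  shows "polytope_inverse P \<in> Zc"
proof -
  have "bounded (rel_interior P)"
    by (rule bounded_subset[OF polytope_imp_bounded[OF assms] rel_interior_subset])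
  then have ri: "indicator (rel_interior P) \<in> Zc"
    by (intro Zc_indicator rel_interior_in_halfspace_ring polytope_imp_polyhedron assms)
  have "(\<lambda>x. indicator (rel_interior P) (0 - x) :: int) \<in> Zc" by (rule Zc_reflect[OF ri])
  from Zc_combine[OF this this, of "\<lambda>a b. (-1) ^ nat (aff_dim P) * a"]
  show ?thesis by (simp add: polytope_inverse_def)
qed

lemma conv_polytope_inverse:
  assumes P: "polytope P" "P \<noteq> {}"
  shows "conv (indicator P) (polytope_inverse P) = indicator {0}"
proof
  fix x
  let ?c = "(-1) ^ nat (aff_dim P) :: int"
  let ?ri = "rel_interior P"
  define D where "D = {y \<in> P. y - x \<in> ?ri}"
  have cc: "compact P" "convex P" using P by (simp_all add: polytope_imp_compact polytope_imp_convex)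
  have int: "(\<lambda>y. indicator P y * polytope_inverse P (x - y)) = (\<lambda>y. ?c * indicator D y)"
    by (auto simp: polytope_inverse_def D_def indicator_def)
  have "(\<lambda>y. indicator P y * polytope_inverse P (x - y)) \<in> euler_functions"
    by (intro conv_integrand Zc_compact_euler Zc_indicator_polytope polytope_inverse_Zc P)
  then have "(\<lambda>y. ?c * (?c * indicator D y)) \<in> euler_functions"
    unfolding int by (rule euler_functions_scale)
  then have D: "indicator D \<in> euler_functions"
    by (simp flip: mult.assoc power_mult_distrib)
  have conv: "conv (indicator P) (polytope_inverse P) x = ?c * chi (indicator D)"
    unfolding conv_def int by (rule chi_scale[OF D])
  show "conv (indicator P) (polytope_inverse P) x = indicator {0} x"
  proof (cases "x = 0")
    case True
    then have "D = ?ri" using rel_interior_subset by (auto simp: D_def)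
    then show ?thesis
      using True P unfolding conv by (simp add: chi_rel_interior_polytope flip: power_mult_distrib)
  next
    case False
    have "chi (indicator D) = 0"
    proof (rule chi_eq_0_lines[OF D, where b = x])
      have "{y. indicator D y \<noteq> (0::int)} \<subseteq> P" by (auto simp: D_def indicator_def)
      then show "bounded {y. indicator D y \<noteq> (0::int)}"
        by (rule bounded_subset[OF compact_imp_bounded[OF cc(1)]])
      fix y
      let ?O = "{t. y + t *\<^sub>R x \<in> ?ri}"
      \<comment> \<open>Subtracting \<open>x\<close> shifts the parameter by 1. For
        \<open>p < q\<close> the section of \<open>D\<close> is thus \<open>{p..q}\<close>
        intersected with \<open>{p<..<q}\<close> moved by 1, which is half-open or empty.\<close>
      have J: "y + t *\<^sub>R x \<in> D \<longleftrightarrow> y + t *\<^sub>R x \<in> P \<and> t - 1 \<in> ?O" for t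
        by (simp add: D_def algebra_simps)
      have zero: "chi (\<lambda>t. indicator D (y + t *\<^sub>R x)) = 0" if none: "\<And>t. y + t *\<^sub>R x \<notin> D"
        using none by (simp add: indicator_def)
      show "chi (\<lambda>t. indicator D (y + t *\<^sub>R x)) = 0"
      proof (cases "?O = {}")
        case True
        then show ?thesis by (intro zero) (auto simp: J)
      next
        case ne: False
        obtain p q where pq: "{t. y + t *\<^sub>R x \<in> P} = {p..q}" "p \<le> q"
          "p < q \<Longrightarrow> ?O = {p<..<q}"
          using rel_interior_line_section[OF cc False ne] by blast
        have in_P: "y + t *\<^sub>R x \<in> P \<longleftrightarrow> p \<le> t \<and> t \<le> q" for t
          using pq(1) by (metis (no_types, lifting) atLeastAtMost_iff mem_Collect_eq)
        have O_sub: "?O \<subseteq> {t. y + t *\<^sub>R x \<in> P}" using rel_interior_subset by blast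
        show ?thesis
        proof (cases "p + 1 < q")
          case True
          have "(\<lambda>t. indicator D (y + t *\<^sub>R x)) = (indicator {p + 1<..q} :: real \<Rightarrow> int)"
            using True pq(3) by (intro ext) (auto simp: indicator_def J in_P)
          then show ?thesis using chi_half_open_interval[OF True] by simp
        next
          case short: False
          \<comment> \<open>When the length \<open>q - p\<close> is at most 1, the shifted section
            lies entirely to the right of \<open>q\<close>; this includes the case
            \<open>p = q\<close>.\<close>
          have "t - 1 \<notin> ?O" if "t \<le> q" for t
          proof (cases "p < q")
            case True
            then show ?thesis using pq(3) short that by auto
          next
            case False
            then show ?thesis using O_sub pq(1,2) that by auto
          qed
          then show ?thesis by (intro zero) (simp add: J in_P)
        qed
      qed
    qed
    then show ?thesis using False conv by simp
  qed
qed

text \<open>Inverses in a commutative monoid are unique: a competitor \<open>\<beta>\<close> is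
  multiplied by the identity, written as the product of \<open>indicator P\<close> with
  \<open>polytope_inverse P\<close>, and the factors are regrouped.\<close>

lemma mink_inverse_polytope:
  assumes P: "polytope P" "P \<noteq> {}"
  shows "mink_inverse (indicator P) = polytope_inverse P"
  unfolding mink_inverse_def
proof (rule the_equality)
  let ?I = "indicator P :: 'a \<Rightarrow> int"
  have I: "?I \<in> Zc" "polytope_inverse P \<in> Zc"
    using P by (simp_all add: Zc_indicator_polytope polytope_inverse_Zc)
  then show "polytope_inverse P \<in> Zc \<and> ?I \<star> polytope_inverse P = indicator {0}"
    by (simp add: mink_prod_eq_conv conv_polytope_inverse P)
  fix \<beta> assume \<beta>: "\<beta> \<in> Zc \<and> ?I \<star> \<beta> = indicator {0}"
  note C = Zc_compact_euler[OF I(1)] Zc_compact_euler[OF I(2)] Zc_compact_euler[OF conjunct1[OF \<beta>]]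
  have "\<beta> = conv \<beta> (conv ?I (polytope_inverse P))"
    by (simp add: conv_polytope_inverse P conv_indicator_0 C)
  also have "\<dots> = conv (conv ?I \<beta>) (polytope_inverse P)"
    by (simp add: conv_assoc[OF C(3,1,2), symmetric] conv_commute[OF C(3,1)])
  also have "conv ?I \<beta> = indicator {0}"
    using \<beta> mink_prod_eq_conv[OF I(1) conjunct1[OF \<beta>]] by metis
  also have "conv (indicator {0}) (polytope_inverse P) = polytope_inverse P"
    using conv_commute[OF C(2) compact_euler_indicator[of "{0}"]] conv_indicator_0[OF C(2)] by simp
  finally show "\<beta> = polytope_inverse P" .
qed

text \<open>Turns division by a polytope into multiplication: to recognize \<open>f\<close> as a
  quotient it is enough to know its convolution with the divisor.\<close>

lemma mink_prod_inverse_eq: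
  assumes P: "polytope P" "P \<noteq> {}" and f: "f \<in> Zc" "g \<in> Zc"
    and eq: "conv f (indicator P) = g"
  shows "g \<star> mink_inverse (indicator P) = f"
proof -
  have I: "(indicator P :: 'a \<Rightarrow> int) \<in> Zc" "polytope_inverse P \<in> Zc"
    using P by (simp_all add: Zc_indicator_polytope polytope_inverse_Zc)
  have "g \<star> mink_inverse (indicator P) = conv (conv f (indicator P)) (polytope_inverse P)"
    using I f by (simp add: mink_inverse_polytope P mink_prod_eq_conv eq)
  also have "\<dots> = conv f (indicator {0})"
    using conv_assoc[OF f(1)[THEN Zc_compact_euler] I[THEN Zc_compact_euler]]
    by (simp add: conv_polytope_inverse P)
  also have "\<dots> = f" by (rule conv_indicator_0[OF Zc_compact_euler[OF f(1)]])
  finally show ?thesis .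
qed

section \<open>Coconvex bodies\<close>

locale pointed_cone =
  fixes C :: "'a::euclidean_space set" and \<xi> :: "'a \<Rightarrow> real"
  assumes closed_C: "closed C" and convex_cone_C: "convex_cone C" and interior_C: "interior C \<noteq> {}"
    and linear_\<xi>: "linear \<xi>" and \<xi>_nonneg: "x \<in> C \<Longrightarrow> 0 \<le> \<xi> x"
    and \<xi>_eq_0: "x \<in> C \<Longrightarrow> \<xi> x = 0 \<Longrightarrow> x = 0"
begin

lemma zero_in_C: "0 \<in> C"
  and add_in_C: "x \<in> C \<Longrightarrow> y \<in> C \<Longrightarrow> x + y \<in> C"
  and scale_in_C: "x \<in> C \<Longrightarrow> 0 \<le> c \<Longrightarrow> c *\<^sub>R x \<in> C"
  using convex_cone_C convex_cone_iff[of C] by (auto simp: convex_cone_def)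

lemma \<xi>_simps [simp]: "\<xi> 0 = 0" "\<xi> (x + y) = \<xi> x + \<xi> y" "\<xi> (c *\<^sub>R x) = c * \<xi> x"
  using linear_\<xi> by (simp_all add: linear_0 linear_add linear_cmul)

lemma nonzero_in_C: obtains x where "x \<in> C" "0 < \<xi> x"
proof -
  have "C \<noteq> {0}" using interior_C by auto
  then obtain x where "x \<in> C" "x \<noteq> 0" using zero_in_C by blast
  with that[of x] show ?thesis using \<xi>_nonneg[of x] \<xi>_eq_0[of x] by fastforce
qed

text \<open>On the compact intersection of \<open>C\<close> with the unit sphere, \<xi> has a
  positive minimum; homogeneity extends the bound to all of \<open>C\<close>.\<close>

lemma norm_le_\<xi>: obtains m where "0 < m" "\<And>x. x \<in> C \<Longrightarrow> m * norm x \<le> \<xi> x"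
proof -
  have cont: "continuous_on (C \<inter> sphere 0 1) \<xi>"
    using linear_\<xi> by (rule linear_continuous_on_compose[OF continuous_on_id, simplified])
  have comp: "compact (C \<inter> sphere 0 1)" using closed_C by (intro closed_Int_compact compact_sphere)
  obtain m where m: "0 < m" "\<And>x. x \<in> C \<inter> sphere 0 1 \<Longrightarrow> m \<le> \<xi> x"
  proof (cases "C \<inter> sphere 0 1 = {}")
    case True
    then show thesis using that[of 1] by auto
  next
    case False
    obtain z where z: "z \<in> C \<inter> sphere 0 1" "\<And>x. x \<in> C \<inter> sphere 0 1 \<Longrightarrow> \<xi> z \<le> \<xi> x"
      using continuous_attains_inf[OF comp False cont] by blast
    then have "0 < \<xi> z" using \<xi>_nonneg[of z] \<xi>_eq_0[of z] by fastforce
    with z that show thesis by blast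
  qed
  have "m * norm x \<le> \<xi> x" if x: "x \<in> C" for x
  proof (cases "x = 0")
    case False
    then have "inverse (norm x) *\<^sub>R x \<in> C \<inter> sphere 0 1"
      using x by (simp add: scale_in_C)
    then have "m \<le> inverse (norm x) * \<xi> x" using m(2) by fastforce
    then show ?thesis using False by (simp add: field_simps)
  qed simp
  with m(1) that show ?thesis by blast
qed

lemma polyhedron_\<xi>_le: "polyhedron {x. \<xi> x \<le> t}"
proof -
  have "\<xi> x = adjoint \<xi> 1 \<bullet> x" for x
    using adjoint_works[OF linear_\<xi>, of x 1] by (simp add: inner_commute)
  then show ?thesis by (simp add: polyhedron_halfspace_le)
qed

lemma bounded_trunc: "S \<subseteq> C \<Longrightarrow> bounded (S \<inter> {x. \<xi> x \<le> t})"
proof -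
  assume S: "S \<subseteq> C"
  obtain m where m: "0 < m" "\<And>x. x \<in> C \<Longrightarrow> m * norm x \<le> \<xi> x" using norm_le_\<xi> by blast
  have "norm x \<le> t / m" if "x \<in> S \<inter> {x. \<xi> x \<le> t}" for x
  proof -
    have "m * norm x \<le> t" using m(2)[of x] that S by fastforce
    then show ?thesis using m(1) by (simp add: field_simps)
  qed
  then show ?thesis unfolding bounded_iff by blast
qed

lemma polytope_trunc: "polyhedron S \<Longrightarrow> S \<subseteq> C \<Longrightarrow> polytope (S \<inter> {x. \<xi> x \<le> t})"
  by (simp add: polytope_eq_bounded_polyhedron polyhedron_\<xi>_le bounded_trunc)

text \<open>\<xi> is bounded on the bounded set \<open>C - \<Delta>\<close>, by \<open>K * R\<close>
  in the proof; adding 1 passes strictly beyond this bound.\<close>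

lemma coconvex_body_large:
  assumes "coconvex_body C \<Delta> A"
  obtains T where "0 < T" "\<And>x. x \<in> C \<Longrightarrow> T \<le> \<xi> x \<Longrightarrow> x \<in> \<Delta>"
proof -
  obtain R where R: "0 < R" "\<And>x. x \<in> C - \<Delta> \<Longrightarrow> norm x \<le> R"
    using assms unfolding coconvex_body_def bounded_pos by blast
  obtain K where K: "0 < K" "\<And>x. norm (\<xi> x) \<le> K * norm x"
    using linear_bounded_pos[OF linear_\<xi>] by blast
  have "x \<in> \<Delta>" if x: "x \<in> C" "K * R + 1 \<le> \<xi> x" for x
  proof (rule ccontr)
    assume "x \<notin> \<Delta>"
    then have "K * norm x \<le> K * R" using R(2) K(1) x by (simp add: mult_left_mono)
    then show False using K(2)[of x] x by simp
  qed
  moreover have "0 < K * R + 1" using K R by (simp add: add_pos_pos)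
  ultimately show ?thesis using that by blast
qed

lemma coconvex_body_scale_large:
  assumes "coconvex_body C \<Delta> A" "x \<in> C" "x \<noteq> 0"
  obtains s0 where "0 < s0" "\<And>s. s0 \<le> s \<Longrightarrow> s *\<^sub>R x \<in> \<Delta>"
proof -
  obtain T where T: "0 < T" "\<And>x. x \<in> C \<Longrightarrow> T \<le> \<xi> x \<Longrightarrow> x \<in> \<Delta>"
    using coconvex_body_large[OF assms(1)] by blast
  have pos: "0 < \<xi> x" using \<xi>_nonneg[of x] \<xi>_eq_0[of x] assms by fastforce
  have "s *\<^sub>R x \<in> \<Delta>" if s: "T / \<xi> x \<le> s" for s
  proof (rule T(2))
    have "0 \<le> T / \<xi> x" using T(1) pos by simp
    then show "s *\<^sub>R x \<in> C" using s by (intro scale_in_C assms(2)) linarith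
    show "T \<le> \<xi> (s *\<^sub>R x)" using s pos by (simp add: field_simps)
  qed
  then show ?thesis using that[of "T / \<xi> x"] T(1) pos by simp
qed

text \<open>If 0 were in \<Delta>, convexity would put every segment from 0 to a far point of a ray
  of \<open>C\<close> into \<Delta>. Then \<Delta> would be all of \<open>C\<close>, but
  \<open>C - \<Delta>\<close> is nonempty.\<close>

lemma zero_notin_\<Delta>:
  assumes "coconvex_body C \<Delta> A"
  shows "0 \<notin> \<Delta>"
proof
  assume 0: "0 \<in> \<Delta>"
  have "x \<in> \<Delta>" if x: "x \<in> C" for x
  proof (cases "x = 0")
    case False
    obtain s0 where s0: "0 < s0" "\<And>s. s0 \<le> s \<Longrightarrow> s *\<^sub>R x \<in> \<Delta>"
      using coconvex_body_scale_large[OF assms x False] by blast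
    define s where "s = max s0 1"
    have "s *\<^sub>R x \<in> \<Delta>" "1 \<le> s" using s0 by (auto simp: s_def)
    moreover have "convex \<Delta>" using assms by (simp add: coconvex_body_def)
    ultimately have "(1 - inverse s) *\<^sub>R 0 + inverse s *\<^sub>R (s *\<^sub>R x) \<in> \<Delta>"
      using 0 by (intro convexD) (auto simp: inverse_le_1_iff)
    then show ?thesis using \<open>1 \<le> s\<close> by simp
  qed (use 0 in simp)
  then show False using assms by (auto simp: coconvex_body_def)
qed

text \<open>The point \<open>y + z\<close> is a limit of convex combinations of \<open>y\<close>
  with far points of the ray through \<open>z\<close>: the multiple of \<open>z\<close> by
  \<open>s\<close> receives the weight \<open>1 / s\<close>. Closedness gives the claim.\<close>

lemma coconvex_body_add_cone:
  assumes "coconvex_body C \<Delta> A" "y \<in> \<Delta>" "z \<in> C"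
  shows "y + z \<in> \<Delta>"
proof (cases "z = 0")
  case False
  obtain s0 where s0: "0 < s0" "\<And>s. s0 \<le> s \<Longrightarrow> s *\<^sub>R z \<in> \<Delta>"
    using coconvex_body_scale_large[OF assms(1,3) False] by blast
  have conv: "convex \<Delta>" and clo: "closed \<Delta>" using assms by (auto simp: coconvex_body_def)
  define s where "s n = max s0 1 + real n" for n
  have s: "s0 \<le> s n" "1 \<le> s n" for n by (auto simp: s_def)
  have "(1 - inverse (s n)) *\<^sub>R y + inverse (s n) *\<^sub>R (s n *\<^sub>R z) \<in> \<Delta>" for n
    using assms(2) s0(2)[OF s(1)] s(2)[of n] by (intro convexD[OF conv]) (auto simp: inverse_le_1_iff)
  moreover have "inverse (s n) *\<^sub>R (s n *\<^sub>R z) = z" for n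
    using s(2)[of n] by simp
  ultimately have in_\<Delta>: "(1 - inverse (s n)) *\<^sub>R y + z \<in> \<Delta>" for n by simp
  have "filterlim s at_top sequentially"
    unfolding s_def by (rule filterlim_tendsto_add_at_top[OF tendsto_const filterlim_real_sequentially])
  then have "(\<lambda>n. inverse (s n)) \<longlonglongrightarrow> 0" by (rule tendsto_inverse_0_at_top)
  then have "(\<lambda>n. (1 - inverse (s n)) *\<^sub>R y + z) \<longlonglongrightarrow> (1 - 0) *\<^sub>R y + z"
    by (intro tendsto_intros)
  then show ?thesis using closed_sequentially[OF clo in_\<Delta>] by simp
qed (use assms in simp)

text \<open>\<open>C\<close> is the recession cone of \<open>\<Delta>\<close>.\<close>

lemma polyhedron_C:
  assumes \<Delta>: "coconvex_body C \<Delta> A" "polyhedron \<Delta>"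
  shows "polyhedron C"
proof -
  have sub: "\<Delta> \<subseteq> C" using \<Delta> by (simp add: coconvex_body_def)
  obtain x0 where "x0 \<in> C" "0 < \<xi> x0" using nonzero_in_C by blast
  then have "x0 \<in> C" "x0 \<noteq> 0" by auto
  then obtain s0 where "s0 *\<^sub>R x0 \<in> \<Delta>"
    using coconvex_body_scale_large[OF \<Delta>(1)] by blast
  then obtain y where y: "y \<in> \<Delta>" by blast
  obtain F where F: "finite F" "\<Delta> = \<Inter>F" "\<forall>h\<in>F. \<exists>a b. a \<noteq> 0 \<and> h = {x. a \<bullet> x \<le> b}"
    using \<Delta>(2) unfolding polyhedron_def by blast
  obtain a b where ab: "\<And>h. h \<in> F \<Longrightarrow> h = {x. a h \<bullet> x \<le> b h}"
    using F(3) by metis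
  have \<Delta>_iff: "x \<in> \<Delta> \<longleftrightarrow> (\<forall>h\<in>F. a h \<bullet> x \<le> b h)" for x
    using F(2) ab by blast
  have "C = (\<Inter>h\<in>F. {x. a h \<bullet> x \<le> 0})"
  proof (intro equalityI subsetI)
    fix x assume x: "x \<in> C"
    have "a h \<bullet> x \<le> 0" if h: "h \<in> F" for h
    proof (cases "x = 0")
      case False
      obtain s0 where s0: "0 < s0" "\<And>s. s0 \<le> s \<Longrightarrow> s *\<^sub>R x \<in> \<Delta>"
        using coconvex_body_scale_large[OF \<Delta>(1) x False] by blast
      show ?thesis
      proof (rule ccontr)
        assume "\<not> a h \<bullet> x \<le> 0"
        then have pos: "0 < a h \<bullet> x" by simp
        \<comment> \<open>Past \<open>s0\<close> the ray through \<open>x\<close> lies in \<Delta>,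
          but past \<open>b h / (a h \<bullet> x)\<close> it violates the constraint
          \<open>h\<close>; adding 1 makes the violation strict.\<close>
        define s where "s = max s0 (b h / (a h \<bullet> x) + 1)"
        have "s *\<^sub>R x \<in> \<Delta>" by (rule s0(2)) (simp add: s_def)
        then have "s * (a h \<bullet> x) \<le> b h" using \<Delta>_iff h by auto
        moreover have "b h / (a h \<bullet> x) < s" by (simp add: s_def less_max_iff_disj)
        then have "b h < s * (a h \<bullet> x)" using pos by (simp add: field_simps)
        ultimately show False by simp
      qed
    qed simp
    then show "x \<in> (\<Inter>h\<in>F. {x. a h \<bullet> x \<le> 0})" by simp
  next
    fix x assume x: "x \<in> (\<Inter>h\<in>F. {x. a h \<bullet> x \<le> 0})"
    \<comment> \<open>Moving from \<open>y\<close> in direction \<open>x\<close> never leaves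
      \<Delta>, hence never leaves \<open>C\<close>. Scaling such points back by
      \<open>inverse (real (Suc n))\<close> gives points of \<open>C\<close> that tend to
      \<open>x\<close>.\<close>
    have "inverse (real (Suc n)) *\<^sub>R y + x \<in> C" for n
    proof -
      have "a h \<bullet> (y + real (Suc n) *\<^sub>R x) \<le> b h" if h: "h \<in> F" for h
      proof -
        have "a h \<bullet> y \<le> b h" "a h \<bullet> x \<le> 0" using y x h \<Delta>_iff by auto
        moreover from this have "real (Suc n) * (a h \<bullet> x) \<le> 0" by (simp add: mult_nonneg_nonpos)
        ultimately show ?thesis by (simp only: inner_add_right inner_scaleR_right)
      qed
      then have "y + real (Suc n) *\<^sub>R x \<in> C" using \<Delta>_iff sub by blast
      then have "inverse (real (Suc n)) *\<^sub>R (y + real (Suc n) *\<^sub>R x) \<in> C"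
        by (rule scale_in_C) simp
      then show ?thesis by (simp add: scaleR_add_right del: of_nat_Suc)
    qed
    moreover have "(\<lambda>n. inverse (real (Suc n)) *\<^sub>R y + x) \<longlonglongrightarrow> 0 *\<^sub>R y + x"
      by (intro tendsto_intros LIMSEQ_inverse_real_of_nat)
    ultimately show "x \<in> C" using closed_sequentially[OF closed_C] by fastforce
  qed
  then show ?thesis using F(1) by (auto intro!: polyhedron_Inter simp: polyhedron_halfspace_le)
qed

text \<open>The factor \<open>1 / 2\<close> lets every point of \<open>C\<close> beyond level \<open>t\<close> be the sum of its two halves, both
  of which lie in \<open>\<Delta>\<close>.\<close>

definition large :: "'a set \<Rightarrow> real \<Rightarrow> bool" where
  "large \<Delta> t \<longleftrightarrow> 0 < t \<and> (\<forall>x\<in>C. t / 2 \<le> \<xi> x \<longrightarrow> x \<in> \<Delta>)"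

lemma eventually_large:
  assumes "coconvex_body C \<Delta> A"
  shows "\<forall>\<^sub>F t in at_top. large \<Delta> t"
proof -
  obtain T where T: "0 < T" "\<And>x. x \<in> C \<Longrightarrow> T \<le> \<xi> x \<Longrightarrow> x \<in> \<Delta>"
    using coconvex_body_large[OF assms] by blast
  have "large \<Delta> t" if "2 * T \<le> t" for t
    unfolding large_def
  proof (intro conjI ballI impI)
    show "0 < t" using that T(1) by linarith
    fix x assume "x \<in> C" "t / 2 \<le> \<xi> x"
    then show "x \<in> \<Delta>" using that by (intro T(2)) linarith+
  qed
  then show ?thesis unfolding eventually_at_top_linorder by blast
qed

section \<open>Truncations at levels of \<xi>\<close>

abbreviation trunc :: "'a set \<Rightarrow> real \<Rightarrow> 'a set" where
  "trunc S t \<equiv> S \<inter> {x. \<xi> x \<le> t}"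

text \<open>For the harder inclusion, if \<open>x\<close> has level at most \<open>t\<close>,
  nonnegativity of \<xi> keeps both summands at level at most \<open>t\<close>. Otherwise both
  halves of \<open>x\<close> have level between \<open>t / 2\<close> and \<open>t\<close>, and
  largeness puts them in \<open>S\<close> and \<open>T\<close>.\<close>

lemma trunc_set_plus:
  assumes "large S t" "large T t" "S \<subseteq> C" "T \<subseteq> C"
  shows "trunc S t + trunc T t = trunc (S + T) (2 * t)"
proof (intro equalityI subsetI)
  fix x assume "x \<in> trunc S t + trunc T t"
  then obtain y z where "y \<in> trunc S t" "z \<in> trunc T t" "x = y + z" by (auto elim: set_plus_elim)
  then show "x \<in> trunc (S + T) (2 * t)" by (auto intro: set_plus_intro)
next
  fix x assume x: "x \<in> trunc (S + T) (2 * t)"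
  then obtain y z where yz: "y \<in> S" "z \<in> T" "x = y + z" by (auto elim: set_plus_elim)
  have C: "y \<in> C" "z \<in> C" using yz assms by auto
  show "x \<in> trunc S t + trunc T t"
  proof (cases "\<xi> x \<le> t")
    case True
    then have "y \<in> trunc S t" "z \<in> trunc T t"
      using yz \<xi>_nonneg[OF C(1)] \<xi>_nonneg[OF C(2)] by auto
    then show ?thesis unfolding yz(3) by (rule set_plus_intro)
  next
    case False
    let ?h = "(1 / 2) *\<^sub>R x"
    have "?h \<in> C" unfolding yz(3) by (intro scale_in_C add_in_C C) simp
    then have "?h \<in> trunc S t" "?h \<in> trunc T t"
      using False x assms(1,2) by (auto simp: large_def)
    then have "?h + ?h \<in> trunc S t + trunc T t" by (rule set_plus_intro)
    then show ?thesis by (simp flip: scaleR_add_left)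
  qed
qed

lemma large_C: "0 < t \<Longrightarrow> large C t"
  by (simp add: large_def)

lemma coconvex_body_plus_C:
  assumes "coconvex_body C \<Delta> A"
  shows "\<Delta> + C = \<Delta>"
proof (intro equalityI subsetI)
  fix x assume "x \<in> \<Delta> + C"
  then show "x \<in> \<Delta>" using coconvex_body_add_cone[OF assms] by (auto elim!: set_plus_elim)
next
  fix x assume "x \<in> \<Delta>"
  then have "x + 0 \<in> \<Delta> + C" using zero_in_C by (rule set_plus_intro)
  then show "x \<in> \<Delta> + C" by simp
qed

lemma C_plus_C: "C + C = C"
proof (intro equalityI subsetI)
  fix x assume "x \<in> C + C"
  then show "x \<in> C" using add_in_C by (auto elim!: set_plus_elim)
next
  fix x assume "x \<in> C"
  then have "x + 0 \<in> C + C" using zero_in_C by (rule set_plus_intro)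
  then show "x \<in> C + C" by simp
qed

text \<open>Above level \<open>t\<close> the sets \<open>C\<close> and \<Delta> coincide, so
  \<open>C - \<Delta>\<close> is the difference of their truncations; the last term accounts for the
  apex, which \<open>A\<close> omits. Nesting and the factor 1 fit the pattern of
  \<open>conv_lincomb_left\<close>.\<close>

lemma neg_indicator_body:
  assumes "coconvex_body C \<Delta> A" "large \<Delta> t"
  shows "- indicator A = (\<lambda>x. 1 * indicator (trunc \<Delta> t) x + ((- 1) * indicator (trunc C t) x + indicator {0} x) :: int)"
proof
  fix x
  have A: "A = C - (\<Delta> \<union> {0})" and sub: "\<Delta> \<subseteq> C" using assms by (auto simp: coconvex_body_def)
  have "0 < t" using assms(2) by (simp add: large_def)
  have "x \<in> \<Delta>" if "x \<in> C" "t < \<xi> x"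
    using that assms(2) \<open>0 < t\<close> by (auto simp: large_def)
  then show "(- indicator A) x =
      (1 * indicator (trunc \<Delta> t) x + ((- 1) * indicator (trunc C t) x + indicator {0} x) :: int)"
    using sub zero_notin_\<Delta>[OF assms(1)] zero_in_C \<open>0 < t\<close>
    by (cases "x = 0"; cases "\<xi> x \<le> t") (auto simp: A indicator_def)
qed

lemma compact_convex_trunc:
  assumes "polyhedron S" "S \<subseteq> C"
  shows "compact (trunc S t)" "convex (trunc S t)"
  using polytope_trunc[OF assms] by (auto simp: polytope_imp_compact polytope_imp_convex)

lemma conv_body:
  assumes \<Delta>: "coconvex_body C \<Delta> A" "polyhedron \<Delta>" "large \<Delta> t"
    and g: "g \<in> compact_euler_functions"
  shows "conv (- indicator A) g = (\<lambda>x. conv (indicator (trunc \<Delta> t)) g x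
    - conv (indicator (trunc C t)) g x + g x)"
proof -
  have sub: "\<Delta> \<subseteq> C" using \<Delta>(1) by (simp add: coconvex_body_def)
  have D: "(indicator (trunc \<Delta> t) :: 'a \<Rightarrow> int) \<in> compact_euler_functions"
    by (intro compact_euler_indicator compact_convex_trunc \<Delta> sub)
  have K: "(indicator (trunc C t) :: 'a \<Rightarrow> int) \<in> compact_euler_functions"
    by (intro compact_euler_indicator compact_convex_trunc polyhedron_C[OF \<Delta>(1,2)] subset_refl)
  have Z: "(indicator {0} :: 'a \<Rightarrow> int) \<in> compact_euler_functions"
    by (rule compact_euler_indicator) auto
  have "conv (indicator {0}) g = g"
    using conv_commute[OF Z g] conv_indicator_0[OF g] by metis
  then show ?thesis
    unfolding neg_indicator_body[OF \<Delta>(1,3)]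
      conv_lincomb_left[OF D compact_euler_add[OF K Z] g] conv_lincomb_left[OF K Z g]
    by (simp add: algebra_simps)
qed

text \<open>Convolving with the truncated cone doubles the levels of both truncations, and the apex
  term contributes the cone truncated at \<open>t\<close>. Above \<open>t\<close> the truncations of
  \<Delta> and \<open>C\<close> cancel; up to \<open>t\<close> the two cone terms cancel and
  \<Delta> remains.\<close>

lemma conv_body_trunc_C:
  assumes \<Delta>: "coconvex_body C \<Delta> A" "polyhedron \<Delta>" "large \<Delta> t"
  shows "conv (- indicator A) (indicator (trunc C t)) = indicator (trunc \<Delta> t)"
proof
  fix x
  have sub: "\<Delta> \<subseteq> C" using \<Delta>(1) by (simp add: coconvex_body_def)
  have "0 < t" using \<Delta>(3) by (simp add: large_def)
  note K = compact_convex_trunc[OF polyhedron_C[OF \<Delta>(1,2)] subset_refl, of t]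
  note D = compact_convex_trunc[OF \<Delta>(2) sub, of t]
  have "conv (indicator (trunc \<Delta> t)) (indicator (trunc C t)) = indicator (trunc \<Delta> (2 * t))"
    unfolding conv_indicator[OF D K] trunc_set_plus[OF \<Delta>(3) large_C[OF \<open>0 < t\<close>] sub subset_refl]
      coconvex_body_plus_C[OF \<Delta>(1)] ..
  moreover have "conv (indicator (trunc C t)) (indicator (trunc C t)) = indicator (trunc C (2 * t))"
    unfolding conv_indicator[OF K K] C_plus_C
      trunc_set_plus[OF large_C[OF \<open>0 < t\<close>] large_C[OF \<open>0 < t\<close>] subset_refl subset_refl] ..
  ultimately have "conv (- indicator A) (indicator (trunc C t)) x
      = indicator (trunc \<Delta> (2 * t)) x - indicator (trunc C (2 * t)) x + indicator (trunc C t) x"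
    unfolding conv_body[OF \<Delta> compact_euler_indicator[OF K]] by simp
  moreover have "x \<in> \<Delta>" if "x \<in> C" "t < \<xi> x"
    using that \<Delta>(3) \<open>0 < t\<close> by (auto simp: large_def)
  ultimately show "conv (- indicator A) (indicator (trunc C t)) x = indicator (trunc \<Delta> t) x"
    using sub \<open>0 < t\<close> by (auto simp: indicator_def)
qed

lemma neg_indicator_body_Zc:
  assumes \<Delta>: "coconvex_body C \<Delta> A" "polyhedron \<Delta>"
  shows "- indicator A \<in> (Zc :: ('a \<Rightarrow> int) set)"
proof -
  have A: "A = C - (\<Delta> \<union> {0})" "bounded (C - \<Delta>)" using \<Delta>(1) by (auto simp: coconvex_body_def)
  have "A \<in> halfspace_ring"
    unfolding A(1) by (intro halfspace_ring.Diff halfspace_ring.Un polyhedron_in_halfspace_ring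
        polyhedron_C[OF \<Delta>] \<Delta>(2) polytope_imp_polyhedron polytope_sing)
  moreover have "bounded A" by (rule bounded_subset[OF A(2)]) (auto simp: A(1))
  ultimately have "(indicator A :: 'a \<Rightarrow> int) \<in> Zc" by (rule Zc_indicator)
  from Zc_combine[OF this this, of "\<lambda>a b. - a"] show ?thesis
    by (simp add: fun_Compl_def)
qed

lemma neg_indicator_body_eq:
  assumes \<Delta>: "coconvex_body C \<Delta> A" "polyhedron \<Delta>" "large \<Delta> t"
  shows "- indicator A = indicator (trunc \<Delta> t) \<star> mink_inverse (indicator (trunc C t))"
proof -
  have sub: "\<Delta> \<subseteq> C" and "0 < t" using \<Delta> by (auto simp: coconvex_body_def large_def)
  have "0 \<in> trunc C t" using zero_in_C \<open>0 < t\<close> by simp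
  then have "trunc C t \<noteq> {}" by blast
  then show ?thesis
    by (intro mink_prod_inverse_eq[symmetric] polytope_trunc polyhedron_C[OF \<Delta>(1,2)] subset_refl
        neg_indicator_body_Zc[OF \<Delta>(1,2)] Zc_indicator_polytope \<Delta>(2) sub conv_body_trunc_C[OF \<Delta>])
qed

lemma virtual_polytope_neg_indicator_body:
  assumes \<Delta>: "coconvex_body C \<Delta> A" "polyhedron \<Delta>"
  shows "virtual_polytope (- indicator A)"
proof -
  have sub: "\<Delta> \<subseteq> C" using \<Delta> by (auto simp: coconvex_body_def)
  obtain t where t: "large \<Delta> t"
    using eventually_happens'[OF _ eventually_large[OF \<Delta>(1)]] by auto
  then have "0 < t" by (simp add: large_def)
  obtain x where x: "x \<in> C" "0 < \<xi> x" using nonzero_in_C by blast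
  \<comment> \<open>Rescaling \<open>x\<close> to level exactly \<open>t\<close> yields a point of
    \<open>C\<close> far enough out to lie in \<Delta>, so the truncation of \<Delta> is
    nonempty.\<close>
  have "(t / \<xi> x) *\<^sub>R x \<in> C" using x \<open>0 < t\<close> by (intro scale_in_C) auto
  moreover have "\<xi> ((t / \<xi> x) *\<^sub>R x) = t" using x by simp
  ultimately have "(t / \<xi> x) *\<^sub>R x \<in> trunc \<Delta> t" using t \<open>0 < t\<close> by (auto simp: large_def)
  then have "trunc \<Delta> t \<noteq> {}" by blast
  moreover have "0 \<in> trunc C t" using zero_in_C \<open>0 < t\<close> by simp
  then have "trunc C t \<noteq> {}" by blast
  ultimately show ?thesis
    unfolding virtual_polytope_def
    using neg_indicator_body_Zc[OF \<Delta>] neg_indicator_body_eq[OF \<Delta> t]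
      polytope_trunc[OF \<Delta>(2) sub] polytope_trunc[OF polyhedron_C[OF \<Delta>] subset_refl] by blast
qed

text \<open>Expanding the first factor leaves three products with \<open>- indicator B\<close>. The
  one with the truncated cone is the truncation of \<open>\<Delta>\<^sub>B\<close>, which cancels
  against the same term of \<open>- indicator B\<close>. The remainder is compared with the left
  side level by level.\<close>

lemma neg_indicator_body_sum:
  assumes A: "coconvex_body C \<Delta>\<^sub>A A" "polyhedron \<Delta>\<^sub>A"
    and B: "coconvex_body C \<Delta>\<^sub>B B" "polyhedron \<Delta>\<^sub>B"
  shows "- indicator (C - ((\<Delta>\<^sub>A + \<Delta>\<^sub>B) \<union> {0})) = (- indicator A) \<star> (- indicator B)"
proof
  fix x
  obtain t where t: "large \<Delta>\<^sub>A t" "large \<Delta>\<^sub>B t"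
    using eventually_happens'[OF _ eventually_conj[OF eventually_large[OF A(1)] eventually_large[OF B(1)]]]
    by auto
  then have "0 < t" by (simp add: large_def)
  have sub: "\<Delta>\<^sub>A \<subseteq> C" "\<Delta>\<^sub>B \<subseteq> C" using A B by (auto simp: coconvex_body_def)
  note K = compact_convex_trunc[OF polyhedron_C[OF A] subset_refl, of t]
  note DA = compact_convex_trunc[OF A(2) sub(1), of t]
  note DB = compact_convex_trunc[OF B(2) sub(2), of t]
  let ?f = "- indicator A :: 'a \<Rightarrow> int" and ?g = "- indicator B :: 'a \<Rightarrow> int"
  note g = Zc_compact_euler[OF neg_indicator_body_Zc[OF B]]
  have fg: "(?f \<star> ?g) x = conv (indicator (trunc \<Delta>\<^sub>A t)) ?g x - conv (indicator (trunc C t)) ?g x + ?g x"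
    unfolding mink_prod_eq_conv[OF neg_indicator_body_Zc[OF A] neg_indicator_body_Zc[OF B]]
      conv_body[OF A t(1) g] ..
  have "conv (indicator (trunc C t)) ?g = indicator (trunc \<Delta>\<^sub>B t)"
    unfolding conv_commute[OF compact_euler_indicator[OF K] g] by (rule conv_body_trunc_C[OF B t(2)])
  moreover have "conv (indicator (trunc \<Delta>\<^sub>A t)) ?g = (\<lambda>x. indicator (trunc (\<Delta>\<^sub>A + \<Delta>\<^sub>B) (2 * t)) x
      - indicator (trunc \<Delta>\<^sub>A (2 * t)) x + indicator (trunc \<Delta>\<^sub>A t) x)"
  proof -
    have "conv (indicator (trunc \<Delta>\<^sub>B t)) (indicator (trunc \<Delta>\<^sub>A t)) = indicator (trunc (\<Delta>\<^sub>A + \<Delta>\<^sub>B) (2 * t))"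
      unfolding conv_indicator[OF DB DA] trunc_set_plus[OF t(2,1) sub(2,1)] add.commute[of \<Delta>\<^sub>B] ..
    moreover have "conv (indicator (trunc C t)) (indicator (trunc \<Delta>\<^sub>A t)) = indicator (trunc \<Delta>\<^sub>A (2 * t))"
      unfolding conv_indicator[OF K DA]
        trunc_set_plus[OF large_C[OF \<open>0 < t\<close>] t(1) subset_refl sub(1)]
        add.commute[of C] coconvex_body_plus_C[OF A(1)] ..
    ultimately show ?thesis
      unfolding conv_commute[OF compact_euler_indicator[OF DA] g]
        conv_body[OF B t(2) compact_euler_indicator[OF DA]] by simp
  qed
  moreover have "?g x = indicator (trunc \<Delta>\<^sub>B t) x - indicator (trunc C t) x + indicator {0} x"
    using fun_cong[OF neg_indicator_body[OF B(1) t(2)], of x] by simp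
  ultimately have prod: "(?f \<star> ?g) x = indicator (trunc (\<Delta>\<^sub>A + \<Delta>\<^sub>B) (2 * t)) x
      - indicator (trunc \<Delta>\<^sub>A (2 * t)) x + indicator (trunc \<Delta>\<^sub>A t) x
      - indicator (trunc C t) x + indicator {0} x"
    unfolding fg by simp
  have sum_sub: "\<Delta>\<^sub>A + \<Delta>\<^sub>B \<subseteq> \<Delta>\<^sub>A"
    using set_plus_mono2[OF subset_refl sub(2)] coconvex_body_plus_C[OF A(1)] by metis
  have 0: "0 \<notin> \<Delta>\<^sub>A" by (rule zero_notin_\<Delta>[OF A(1)])
  have in_A: "x \<in> \<Delta>\<^sub>A" if "x \<in> C" "t < \<xi> x"
    using that t(1) \<open>0 < t\<close> by (auto simp: large_def)
  have in_sum: "x \<in> \<Delta>\<^sub>A + \<Delta>\<^sub>B" if x: "x \<in> C" "2 * t < \<xi> x"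
  proof -
    let ?h = "(1 / 2) *\<^sub>R x"
    have "?h \<in> C" using x(1) by (rule scale_in_C) simp
    then have "?h \<in> \<Delta>\<^sub>A" "?h \<in> \<Delta>\<^sub>B" using t x \<open>0 < t\<close> by (auto simp: large_def)
    then have "?h + ?h \<in> \<Delta>\<^sub>A + \<Delta>\<^sub>B" by (rule set_plus_intro)
    then show ?thesis by (simp flip: scaleR_add_left)
  qed
  \<comment> \<open>Between \<open>t\<close> and \<open>2 * t\<close> the set
    \<open>\<Delta>\<^sub>A\<close> agrees with \<open>C\<close>; above \<open>2 * t\<close> all
    truncations vanish, and \<open>\<Delta>\<^sub>A + \<Delta>\<^sub>B\<close> agrees with
    \<open>C\<close> too.\<close>
  consider "x = 0" | "x \<noteq> 0" "\<xi> x \<le> t" | "x \<noteq> 0" "t < \<xi> x" "\<xi> x \<le> 2 * t" | "x \<noteq> 0" "2 * t < \<xi> x"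
    by linarith
  then show "(- indicator (C - ((\<Delta>\<^sub>A + \<Delta>\<^sub>B) \<union> {0}))) x = (?f \<star> ?g) x"
    unfolding prod using sum_sub sub(1) 0 in_A in_sum zero_in_C \<open>0 < t\<close>
    by cases (auto simp: indicator_def)
qed

end

theorem theoremB:
  fixes C \<Delta> A :: "'a::euclidean_space set" and \<xi> :: "'a \<Rightarrow> real"
  assumes "closed C" and "strictly_convex_cone C" and "interior C \<noteq> {}"
    and "coconvex_body C \<Delta> A" and "polyhedron \<Delta>"
    and "linear \<xi>" and "\<forall>x\<in>C. \<xi> x \<ge> 0" and "\<xi> -` {0} \<inter> C = {0}"
  shows "virtual_polytope (- indicator A) \<and>
    (\<forall>\<^sub>F t in at_top. - indicator A =
        indicator (\<Delta> \<inter> {x. \<xi> x \<le> t}) \<star> mink_inverse (indicator (C \<inter> {x. \<xi> x \<le> t}))) \<and>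
    (\<forall>\<Delta>\<^sub>A \<Delta>\<^sub>B A B.
        coconvex_body C \<Delta>\<^sub>A A \<and> polyhedron \<Delta>\<^sub>A \<and> coconvex_body C \<Delta>\<^sub>B B \<and> polyhedron \<Delta>\<^sub>B \<longrightarrow>
        - indicator (C - ((\<Delta>\<^sub>A + \<Delta>\<^sub>B) \<union> {0})) = (- indicator A) \<star> (- indicator B))"
proof -
  interpret pointed_cone C \<xi>
    using assms by (intro pointed_cone.intro) (auto simp: strictly_convex_cone_def)
  have "\<forall>\<^sub>F t in at_top. - indicator A =
      indicator (\<Delta> \<inter> {x. \<xi> x \<le> t}) \<star> mink_inverse (indicator (C \<inter> {x. \<xi> x \<le> t}))"
    using eventually_large[OF assms(4)]
    by (rule eventually_mono) (rule neg_indicator_body_eq[OF assms(4,5)])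
  then show ?thesis
    using virtual_polytope_neg_indicator_body[OF assms(4,5)] neg_indicator_body_sum by blast
qed

end
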